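(* For every fixed $\epsilon$ with $0<\epsilon\le\frac1{100}$, with high probability, for every integer $k$ with $0\le k<\epsilon^3 n$, \[|\mathcal L_k\cap C_{\tau_{\mathrm{end}}}|\ge (1-2\epsilon)\binom nk.\]
   Context: Let $n\ge 1$ and $\mathcal B=\{0,1\}^n$ with the coordinatewise partial order; $\mathbf 0=(0,\dots,0)$, $\mathbf 1=(1,\dots,1)$, $|x|$ denotes the number of ones of $x$, and $\mathcal L_k=\{x\in\mathcal B:|x|=k\}$ is the $k$th level, so $|\mathcal L_k|=\binom nk$. A random decreasing walk from $\mathbf 1$ is a maximal chain $\mathbf 1=x_n>x_{n-1}>\dots>x_0=\mathbf 0$ with $x_i\in\mathcal L_i$, chosen uniformly among all $n!$ such chains (equivalently, each step turns a uniformly random remaining $1$ into $0$). The DLA process on $\mathcal B$: $C_0=\{\mathbf 0\}$; for $t\ge1$, let $\rho_t$ be a random decreasing walk from $\mathbf 1$, independent of everything before; let $v$ be the last vertex of the longest initial segment of $\rho_t$ that is disjoint from $C_{t-1}$, and set $C_t=C_{t-1}\cup\{v\}$. The process terminates at the first time $\tau_{\mathrm{end}}$ with $\mathbf 1\in C_{\tau_{\mathrm{end}}}$ (for $t>\tau_{\mathrm{end}}$ put $C_t=C_{\tau_{\mathrm{end}}}$). A vertex is occupied at time $t$ if it lies in $C_t$. "With high probability" (w.h.p.) means with probability tending to $1$ as $n\to\infty$. *)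

theory Defs
  imports "HOL-Probability.Probability" "HOL-Combinatorics.Multiset_Permutations"
begin

text \<open>Vertices of the hypercube {0,1}^n are encoded as subsets of {0..<n}
  (the set of coordinates equal to 1); |x| = card x, the all-ones vertex is
  {0..<n}, the all-zeros vertex is {}.  A maximal decreasing chain from the
  all-ones vertex corresponds to a permutation sigma (a distinct list) of
  {0..<n}: the vertex after j steps is {0..<n} minus the first j entries.\<close>

definition walk_vertex :: "nat \<Rightarrow> nat list \<Rightarrow> nat \<Rightarrow> nat set" where
  "walk_vertex n \<sigma> j = {0..<n} - set (take j \<sigma>)"

definition dla_step :: "nat \<Rightarrow> nat set set \<Rightarrow> nat set set pmf" where
  "dla_step n C =
     (if {0..<n} \<in> C then return_pmf C
      else map_pmf
        (\<lambda>\<sigma>. insert (walk_vertex n \<sigma> (LEAST j. walk_vertex n \<sigma> (Suc j) \<in> C)) C)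
        (pmf_of_set (permutations_of_set {0..<n})))"

definition dla :: "nat \<Rightarrow> nat \<Rightarrow> nat set set pmf" where
  "dla n t = ((\<lambda>p. bind_pmf p (dla_step n)) ^^ t) (return_pmf {{}})"

text \<open>Distribution of the final cluster C_{tau_end}.  Before termination each
  step adds a new vertex, so tau_end \<le> 2^n - 1 and C_{tau_end} = C_{2^n}.\<close>

definition dla_final :: "nat \<Rightarrow> nat set set pmf" where
  "dla_final n = dla n (2 ^ n)"

end

theory Submission
  imports Defs "HOL-Real_Asymp.Real_Asymp"
begin

text \<open>
  Level \<open>k\<close> is filled by the time \<open>T k\<close>, roughly \<open>(n choose (k + 1)) / 20\<close>. Every walk crosses level \<open>j\<close> at a
  uniform vertex, so at time \<open>T k\<close> the occupied part of each level \<open>j > k\<close> is dominated by a sparse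
  random set, and with overwhelming probability every vertex \<open>v\<close> of level \<open>k\<close> is reached by at least
  half of the walks aimed at it. This is a union bound over the levels \<open>j < n / 5\<close>; higher
  levels are still empty, since a cluster has to climb level by level.

  If moreover at time \<open>T (k - 1)\<close> at least half of the lower neighbours of every vertex of level \<open>k\<close>
  are occupied, each still unoccupied vertex of level \<open>k\<close> gets occupied at rate at least
  \<open>1 / (4 (n choose k))\<close> per step until time \<open>T k\<close>. As \<open>T k - T (k - 1)\<close> is about
  \<open>n / (20 k)\<close> times \<open>n choose k\<close>, the probability that some vertex of level \<open>k + 1\<close> has more than
  \<open>2 \<epsilon> (k + 1)\<close> unoccupied lower neighbours at time \<open>T k\<close> is exponentially small in \<open>n\<close>. This
  reproduces the hypothesis one level higher without accumulating errors, and by double counting it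
  gives the density \<open>1 - 2 \<epsilon>\<close> of level \<open>k\<close>.
\<close>

subsection \<open>Counting permutations\<close>

text \<open>Cutting a list after \<open>card Y\<close> entries and concatenating the two pieces are
  mutually inverse. The predicates \<open>P\<close> and \<open>R\<close> on the pieces give the
  independence of the parts of a walk above and below a prescribed vertex.\<close>

lemma card_permutations_of_set_split:
  assumes "finite A" "Y \<subseteq> A"
  shows "card {\<sigma> \<in> permutations_of_set A. set (take (card Y) \<sigma>) = Y \<and>
            P (take (card Y) \<sigma>) \<and> R (drop (card Y) \<sigma>)} =
         card {\<alpha> \<in> permutations_of_set Y. P \<alpha>} * card {\<beta> \<in> permutations_of_set (A - Y). R \<beta>}"
proof -
  let ?L = "{\<sigma> \<in> permutations_of_set A. set (take (card Y) \<sigma>) = Y \<and>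
            P (take (card Y) \<sigma>) \<and> R (drop (card Y) \<sigma>)}"
  let ?R = "{\<alpha> \<in> permutations_of_set Y. P \<alpha>} \<times> {\<beta> \<in> permutations_of_set (A - Y). R \<beta>}"
  have "bij_betw (\<lambda>(\<alpha>, \<beta>). \<alpha> @ \<beta>) ?R ?L"
  proof (rule bij_betw_byWitness[where f' = "\<lambda>\<sigma>. (take (card Y) \<sigma>, drop (card Y) \<sigma>)"], goal_cases)
    case 1
    show ?case by (auto simp: permutations_of_set_def distinct_card[symmetric])
  next
    case 2
    show ?case by auto
  next
    case 3
    show ?case using assms
      by (auto simp: permutations_of_set_def distinct_card)
  next
    case 4
    show ?case
    proof safe
      fix \<sigma> assume s: "\<sigma> \<in> permutations_of_set A" "set (take (card Y) \<sigma>) = Y"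
      have d: "distinct \<sigma>" "set \<sigma> = A" using s by (auto simp: permutations_of_set_def)
      have "set (take (card Y) \<sigma>) \<union> set (drop (card Y) \<sigma>) = A"
        by (metis append_take_drop_id d(2) set_append)
      moreover have "set (take (card Y) \<sigma>) \<inter> set (drop (card Y) \<sigma>) = {}"
        using d by (simp add: set_take_disj_set_drop_if_distinct)
      ultimately have "set (drop (card Y) \<sigma>) = A - Y" using s(2) by blast
      then show "drop (card Y) \<sigma> \<in> permutations_of_set (A - Y)"
        using d by (auto simp: permutations_of_set_def)
      show "take (card Y) \<sigma> \<in> permutations_of_set Y"
        using s d by (auto simp: permutations_of_set_def)
    qed
  qed
  then have "card ?R = card ?L" by (rule bij_betw_same_card)
  then show ?thesis by (simp add: card_cartesian_product)
qed

lemma card_permutations_of_set_prefix: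
  assumes "finite A" "Y \<subseteq> A"
  shows "card {\<sigma> \<in> permutations_of_set A. set (take (card Y) \<sigma>) = Y} =
         fact (card Y) * fact (card A - card Y)"
  using card_permutations_of_set_split[OF assms, of "\<lambda>_. True" "\<lambda>_. True"] assms
  by (simp add: finite_subset card_Diff_subset)

lemma card_permutations_of_set_nth_0:
  assumes "finite A" "a \<in> A"
  shows "card {\<sigma> \<in> permutations_of_set A. \<sigma> ! 0 = a} = fact (card A - 1)"
proof -
  have "set (take 1 \<sigma>) = {a} \<longleftrightarrow> \<sigma> ! 0 = a" if "\<sigma> \<in> permutations_of_set A" for \<sigma>
    using that assms by (cases \<sigma>) (auto simp: permutations_of_set_def)
  then have "{\<sigma> \<in> permutations_of_set A. \<sigma> ! 0 = a} =
      {\<sigma> \<in> permutations_of_set A. set (take (card {a}) \<sigma>) = {a}}" by auto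
  then show ?thesis
    using card_permutations_of_set_prefix[of A "{a}"] assms by simp
qed

lemma card_permutations_of_set_nth_0_in:
  assumes "finite A" "B \<subseteq> A"
  shows "card {\<sigma> \<in> permutations_of_set A. \<sigma> ! 0 \<in> B} = card B * fact (card A - 1)"
proof -
  have "{\<sigma> \<in> permutations_of_set A. \<sigma> ! 0 \<in> B} =
        (\<Union>a\<in>B. {\<sigma> \<in> permutations_of_set A. \<sigma> ! 0 = a})" by auto
  also have "card \<dots> = (\<Sum>a\<in>B. card {\<sigma> \<in> permutations_of_set A. \<sigma> ! 0 = a})"
    using assms by (intro card_UN_disjoint) (auto intro: finite_subset)
  also have "\<dots> = (\<Sum>a\<in>B. fact (card A - 1))"
    using assms by (intro sum.cong card_permutations_of_set_nth_0) auto
  finally show ?thesis by simp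
qed


subsection \<open>Random walks\<close>

lemma permutations_upt_D:
  assumes "\<sigma> \<in> permutations_of_set {0..<n}"
  shows "distinct \<sigma>" "set \<sigma> = {0..<n}" "length \<sigma> = n"
  using assms distinct_card[of \<sigma>] by (auto simp: permutations_of_set_def)

lemma walk_vertex_subset: "walk_vertex n \<sigma> j \<subseteq> {0..<n}"
  by (auto simp: walk_vertex_def)

lemma card_walk_vertex:
  assumes "\<sigma> \<in> permutations_of_set {0..<n}" "j \<le> n"
  shows "card (walk_vertex n \<sigma> j) = n - j"
proof -
  note s = permutations_upt_D[OF assms(1)]
  have "card (set (take j \<sigma>)) = j" using s assms by (simp add: distinct_card)
  moreover have "set (take j \<sigma>) \<subseteq> {0..<n}" using s set_take_subset by metis
  ultimately show ?thesis by (simp add: walk_vertex_def card_Diff_subset)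
qed

lemma walk_vertex_Suc:
  assumes "\<sigma> \<in> permutations_of_set {0..<n}" "j < n"
  shows "walk_vertex n \<sigma> (Suc j) = walk_vertex n \<sigma> j - {\<sigma> ! j}"
  using permutations_upt_D[OF assms(1)] assms(2)
  by (auto simp: walk_vertex_def take_Suc_conv_app_nth)

lemma nth_in_walk_vertex:
  assumes "\<sigma> \<in> permutations_of_set {0..<n}" "j < n"
  shows "\<sigma> ! j \<in> walk_vertex n \<sigma> j"
  using permutations_upt_D[OF assms(1)] assms(2)
  by (auto simp: walk_vertex_def in_set_conv_nth nth_eq_iff_index_eq) (metis nth_mem atLeastLessThan_iff)

lemma walk_vertex_eq_iff:
  assumes "\<sigma> \<in> permutations_of_set {0..<n}" "x \<subseteq> {0..<n}"
  shows "walk_vertex n \<sigma> j = x \<longleftrightarrow> set (take j \<sigma>) = {0..<n} - x"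
proof -
  have "set (take j \<sigma>) \<subseteq> {0..<n}" using permutations_upt_D[OF assms(1)] set_take_subset by metis
  then show ?thesis using assms(2) unfolding walk_vertex_def by blast
qed

lemma prob_walk:
  "measure_pmf.prob (pmf_of_set (permutations_of_set {0..<n})) {\<sigma>. P \<sigma>} =
     card {\<sigma> \<in> permutations_of_set {0..<n}. P \<sigma>} / fact n"
  by (subst measure_pmf_of_set) (auto simp: Int_def)

text \<open>Level \<open>k\<close> is reached after \<open>n - k\<close> steps, when exactly the
  complement of \<open>x\<close> has been removed. The walks through \<open>x\<close> therefore form
  a product: an ordering of the complement, then an ordering of \<open>x\<close>.\<close>

lemma card_walks_through:
  assumes "x \<subseteq> {0..<n}" "card x = k"
  shows "card {\<sigma> \<in> permutations_of_set {0..<n}. walk_vertex n \<sigma> (n - k) = x \<and>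
            P (take (n - k) \<sigma>) \<and> R (drop (n - k) \<sigma>)} =
         card {\<alpha> \<in> permutations_of_set ({0..<n} - x). P \<alpha>} *
         card {\<beta> \<in> permutations_of_set x. R \<beta>}"
proof -
  have c: "card ({0..<n} - x) = n - k" using assms by (simp add: card_Diff_subset finite_subset)
  have "{0..<n} - ({0..<n} - x) = x" using assms by auto
  then show ?thesis
    using card_permutations_of_set_split[of "{0..<n}" "{0..<n} - x" P R] c assms
    by (simp add: walk_vertex_eq_iff cong: conj_cong)
qed

lemma fact_mult_over_fact:
  assumes "k \<le> n"
  shows "real (fact (n - k) * fact k) / fact n = 1 / real (n choose k)"
  using binomial_fact[OF assms, where 'a = real] by simp

lemma prob_walk_through:
  assumes "x \<subseteq> {0..<n}" "card x = k"
  shows "measure_pmf.prob (pmf_of_set (permutations_of_set {0..<n}))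
           {\<sigma>. walk_vertex n \<sigma> (n - k) = x} = 1 / real (n choose k)"
proof -
  have kn: "k \<le> n" using assms card_mono[of "{0..<n}" x] by simp
  have fx: "finite x" using assms finite_subset by auto
  have "card ({0..<n} - x) = n - k" using assms by (simp add: card_Diff_subset finite_subset)
  then have "card {\<sigma> \<in> permutations_of_set {0..<n}. walk_vertex n \<sigma> (n - k) = x} =
     fact (n - k) * fact k"
    using card_walks_through[OF assms, of "\<lambda>_. True" "\<lambda>_. True"] assms fx by simp
  then show ?thesis
    using fact_mult_over_fact[OF kn] by (simp only: prob_walk)
qed

text \<open>Given that the walk visits \<open>x\<close>, the coordinate removed next is uniform
  among the \<open>k\<close> elements of \<open>x\<close>; this is the extra factor
  \<open>1 / k\<close> compared with \<open>prob_walk_through\<close>.\<close>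

lemma prob_walk_through_edge:
  assumes "x \<subseteq> {0..<n}" "card x = k" "a \<in> x"
  shows "measure_pmf.prob (pmf_of_set (permutations_of_set {0..<n}))
           {\<sigma>. walk_vertex n \<sigma> (n - k) = x \<and> \<sigma> ! (n - k) = a} = 1 / (real k * real (n choose k))"
proof -
  have kn: "k \<le> n" using assms card_mono[of "{0..<n}" x] by simp
  have fx: "finite x" using assms finite_subset by auto
  have k0: "k > 0" using assms fx card_gt_0_iff by auto
  have c: "card ({0..<n} - x) = n - k" using assms by (simp add: card_Diff_subset finite_subset)
  have "drop (n - k) \<sigma> ! 0 = \<sigma> ! (n - k)" if "\<sigma> \<in> permutations_of_set {0..<n}" for \<sigma>
    using permutations_upt_D[OF that] kn by simp
  then have "card {\<sigma> \<in> permutations_of_set {0..<n}. walk_vertex n \<sigma> (n - k) = x \<and> \<sigma> ! (n - k) = a} =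
     fact (n - k) * fact (k - 1)"
    using card_walks_through[OF assms(1,2), of "\<lambda>_. True" "\<lambda>\<beta>. \<beta> ! 0 = a"]
      card_permutations_of_set_nth_0[OF fx assms(3)] c assms(2)
    by (simp cong: conj_cong)
  moreover have "real (fact (n - k) * fact (k - 1)) / fact n =
      (real (fact (n - k) * fact k) / fact n) / real k"
    using k0 by (simp add: fact_reduce)
  ultimately show ?thesis
    using fact_mult_over_fact[OF kn] by (simp only: prob_walk) simp
qed

subsection \<open>Clusters\<close>

text \<open>An invariant of the process that stands in for reachability, so that one-step estimates
  can be stated for a fixed state. The last clause forces the process to climb level by
  level.\<close>

definition cluster :: "nat \<Rightarrow> nat set set \<Rightarrow> bool" where
  "cluster n C \<longleftrightarrow> C \<subseteq> Pow {0..<n} \<and> {} \<in> C \<and> (\<forall>x\<in>C. x \<noteq> {} \<longrightarrow> (\<exists>a\<in>x. x - {a} \<in> C))"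

text \<open>Meaningful when the top vertex is unoccupied: the least index whose successor is
  occupied then ends the longest initial segment of the walk that is disjoint from
  \<open>C\<close>.\<close>

definition landing :: "nat \<Rightarrow> nat set set \<Rightarrow> nat list \<Rightarrow> nat set" where
  "landing n C \<sigma> = walk_vertex n \<sigma> (LEAST j. walk_vertex n \<sigma> (Suc j) \<in> C)"

lemma dla_step_landing:
  "{0..<n} \<notin> C \<Longrightarrow> dla_step n C =
     map_pmf (\<lambda>\<sigma>. insert (landing n C \<sigma>) C) (pmf_of_set (permutations_of_set {0..<n}))"
  by (simp add: dla_step_def landing_def)

lemma landingE:
  assumes C: "cluster n C" "{0..<n} \<notin> C" and s: "\<sigma> \<in> permutations_of_set {0..<n}"
  obtains j where "j < n" "landing n C \<sigma> = walk_vertex n \<sigma> j"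
    "walk_vertex n \<sigma> j - {\<sigma> ! j} \<in> C" "\<sigma> ! j \<in> walk_vertex n \<sigma> j" "landing n C \<sigma> \<notin> C"
proof -
  let ?J = "LEAST j. walk_vertex n \<sigma> (Suc j) \<in> C"
  have n0: "n > 0" using C by (cases n) (auto simp: cluster_def)
  \<comment> \<open>The walk ends at the empty set, which every cluster contains, so the least index
    exists and is below \<open>n\<close>.\<close>
  have "walk_vertex n \<sigma> n = {}" using permutations_upt_D[OF s] by (simp add: walk_vertex_def)
  then have e: "walk_vertex n \<sigma> (Suc (n - 1)) \<in> C" using n0 C by (simp add: cluster_def)
  have "?J \<le> n - 1" by (rule Least_le) (rule e)
  then have J: "?J < n" using n0 by simp
  have i: "walk_vertex n \<sigma> (Suc ?J) \<in> C"
    by (rule LeastI[where P = "\<lambda>j. walk_vertex n \<sigma> (Suc j) \<in> C"]) (rule e)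
  \<comment> \<open>Minimality covers only vertices with a predecessor on the walk. At index 0 the
    vertex is the top one, unoccupied by assumption.\<close>
  have "walk_vertex n \<sigma> ?J \<notin> C"
  proof (cases ?J)
    case 0
    then show ?thesis using C by (simp add: walk_vertex_def)
  next
    case (Suc j')
    then have "j' < ?J" by simp
    from not_less_Least[OF this] Suc show ?thesis by simp
  qed
  with that[of ?J] J i show thesis
    using walk_vertex_Suc[OF s J] nth_in_walk_vertex[OF s J] by (simp add: landing_def)
qed

text \<open>Each step lowers the cardinality by one, so the index at which the walk sits at
  \<open>x\<close> is forced to be \<open>n - card x\<close>. Landing at \<open>x\<close> is thereby
  contained in an event about the walk at a fixed time, which yields upper bounds;
  \<open>landing_eqI\<close> serves the lower bounds.\<close>

lemma landing_eqD:
  assumes C: "cluster n C" "{0..<n} \<notin> C" and s: "\<sigma> \<in> permutations_of_set {0..<n}"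
    and "landing n C \<sigma> = x"
  shows "x \<subseteq> {0..<n}" "x \<noteq> {}" "x \<notin> C" "walk_vertex n \<sigma> (n - card x) = x"
    "\<sigma> ! (n - card x) \<in> x" "x - {\<sigma> ! (n - card x)} \<in> C"
proof -
  from landingE[OF C s] obtain j where j: "j < n" "landing n C \<sigma> = walk_vertex n \<sigma> j"
    "walk_vertex n \<sigma> j - {\<sigma> ! j} \<in> C" "\<sigma> ! j \<in> walk_vertex n \<sigma> j" "landing n C \<sigma> \<notin> C" by metis
  have "card x = n - j" using card_walk_vertex[OF s] j assms(4) by simp
  then have "n - card x = j" using j by simp
  then show "x \<subseteq> {0..<n}" "x \<noteq> {}" "x \<notin> C" "walk_vertex n \<sigma> (n - card x) = x"
    "\<sigma> ! (n - card x) \<in> x" "x - {\<sigma> ! (n - card x)} \<in> C"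
    using j assms(4) walk_vertex_subset by auto
qed

lemma landing_eqI:
  assumes s: "\<sigma> \<in> permutations_of_set {0..<n}"
    and x: "card x = k" "k > 0" "k \<le> n" "walk_vertex n \<sigma> (n - k) = x" "x - {\<sigma> ! (n - k)} \<in> C"
    and u: "\<And>i. i \<le> n - k \<Longrightarrow> walk_vertex n \<sigma> i \<notin> C"
  shows "landing n C \<sigma> = x"
proof -
  have "(LEAST j. walk_vertex n \<sigma> (Suc j) \<in> C) = n - k"
  proof (rule Least_equality)
    show "walk_vertex n \<sigma> (Suc (n - k)) \<in> C" using x walk_vertex_Suc[OF s, of "n - k"] by simp
  next
    fix j assume "walk_vertex n \<sigma> (Suc j) \<in> C"
    then show "n - k \<le> j" using u[of "Suc j"] by (meson not_less_eq_eq)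
  qed
  then show ?thesis using x by (simp add: landing_def)
qed

lemma cluster_finite: "cluster n C \<Longrightarrow> finite C"
  unfolding cluster_def using finite_subset by blast

lemma cluster_step:
  assumes "cluster n C" "C' \<in> set_pmf (dla_step n C)"
  shows "cluster n C'" "C \<subseteq> C'"
proof -
  have "cluster n C' \<and> C \<subseteq> C'"
  proof (cases "{0..<n} \<in> C")
    case True
    then show ?thesis using assms by (simp add: dla_step_def)
  next
    case False
    then obtain \<sigma> where s: "\<sigma> \<in> permutations_of_set {0..<n}" "C' = insert (landing n C \<sigma>) C"
      using assms(2) by (auto simp: dla_step_landing)
    note l = landing_eqD[OF assms(1) False s(1) refl]
    then show ?thesis using assms(1) unfolding cluster_def s(2) by blast
  qed
  then show "cluster n C'" "C \<subseteq> C'" by auto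
qed

text \<open>Descend from \<open>x\<close> along occupied lower neighbours; every level below is
  met.\<close>

lemma cluster_levels:
  assumes "cluster n C" "x \<in> C" "j \<le> card x"
  shows "\<exists>y\<in>C. card y = j"
  using assms(2,3)
proof (induction "card x" arbitrary: x)
  case 0
  then show ?case by auto
next
  case (Suc m)
  show ?case
  proof (cases "j = card x")
    case True
    then show ?thesis using Suc by auto
  next
    case False
    have "x \<noteq> {}" using Suc by auto
    then obtain a where a: "a \<in> x" "x - {a} \<in> C"
      using assms(1) Suc.prems unfolding cluster_def by blast
    have "card (x - {a}) = m" using a Suc.hyps(2) by (simp add: card_Diff_singleton)
    then show ?thesis using Suc.hyps(1)[of "x - {a}"] a Suc.hyps(2) Suc.prems False by auto
  qed
qed

section \<open>The process started from an arbitrary cluster, and conditioning\<close>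

definition dla_from :: "nat \<Rightarrow> nat \<Rightarrow> nat set set \<Rightarrow> nat set set pmf" where
  "dla_from n t C = ((\<lambda>p. bind_pmf p (dla_step n)) ^^ t) (return_pmf C)"

lemma dla_from_0: "dla_from n 0 C = return_pmf C"
  by (simp add: dla_from_def)

lemma dla_from_Suc: "dla_from n (Suc t) C = bind_pmf (dla_from n t C) (dla_step n)"
  by (simp add: dla_from_def)

lemma dla_from_add: "dla_from n (s + t) C = bind_pmf (dla_from n s C) (dla_from n t)"
  by (induction t) (simp_all add: dla_from_0[abs_def] dla_from_Suc bind_return_pmf' bind_assoc_pmf)

lemma dla_from_Suc': "dla_from n (Suc t) C = bind_pmf (dla_step n C) (dla_from n t)"
  using dla_from_add[of n 1 t C] by (simp add: dla_from_Suc dla_from_0 bind_return_pmf)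

lemma dla_conv_dla_from: "dla n t = dla_from n t {{}}"
  by (simp add: dla_def dla_from_def)

lemma cluster_dla_from:
  assumes "cluster n C" "C' \<in> set_pmf (dla_from n t C)"
  shows "cluster n C'" "C \<subseteq> C'"
proof -
  have "cluster n C' \<and> C \<subseteq> C'" using assms(2)
  proof (induction t arbitrary: C')
    case 0
    then show ?case using assms(1) by (simp add: dla_from_0)
  next
    case (Suc t)
    then obtain D where "D \<in> set_pmf (dla_from n t C)" "C' \<in> set_pmf (dla_step n D)"
      by (auto simp: dla_from_Suc)
    then show ?case using Suc.IH cluster_step by blast
  qed
  then show "cluster n C'" "C \<subseteq> C'" by auto
qed

lemma cluster_dla:
  assumes "C \<in> set_pmf (dla n t)"
  shows "cluster n C"
proof (rule cluster_dla_from(1))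
  show "cluster n {{}}" by (auto simp: cluster_def)
  show "C \<in> set_pmf (dla_from n t {{}})" using assms by (simp add: dla_conv_dla_from)
qed

lemma dla_Suc: "dla n (Suc t) = bind_pmf (dla n t) (dla_step n)"
  by (simp add: dla_conv_dla_from dla_from_Suc)

lemma dla_add: "dla n (s + t) = bind_pmf (dla n s) (dla_from n t)"
  by (simp add: dla_conv_dla_from dla_from_add)

text \<open>The law of total probability, in the form needed for recursions in time: a pointwise
  bound on the conditional probability by indicators integrates to a bound by probabilities at the
  earlier time.\<close>

lemma prob_bind_pmf_le:
  fixes c :: "'i \<Rightarrow> real"
  assumes "\<And>x. x \<in> set_pmf p \<Longrightarrow> measure_pmf.prob (f x) A \<le> indicator B x + (\<Sum>i\<in>I. c i * indicator (D i) x)"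
  shows "measure_pmf.prob (bind_pmf p f) A \<le> measure_pmf.prob p B + (\<Sum>i\<in>I. c i * measure_pmf.prob p (D i))"
proof -
  have i0: "integrable (measure_pmf p) (\<lambda>x. measure_pmf.prob (f x) A)"
    by (rule measure_pmf.integrable_const_bound[where B = 1]) auto
  have i1: "integrable (measure_pmf p) (\<lambda>x. indicator X x :: real)" for X
    by (rule measure_pmf.integrable_const_bound[where B = 1]) (auto simp: indicator_def)
  have "emeasure (bind_pmf p f) A = (\<integral>\<^sup>+x. ennreal (measure_pmf.prob (f x) A) \<partial>p)"
    by (simp flip: measure_pmf.emeasure_eq_measure)
  also have "\<dots> = ennreal (\<integral>x. measure_pmf.prob (f x) A \<partial>p)"
    by (rule nn_integral_eq_integral[OF i0]) auto
  finally have "measure_pmf.prob (bind_pmf p f) A = (\<integral>x. measure_pmf.prob (f x) A \<partial>p)"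
    by (simp add: measure_pmf.emeasure_eq_measure)
  also have "\<dots> \<le> (\<integral>x. indicator B x + (\<Sum>i\<in>I. c i * indicator (D i) x) \<partial>p)"
    by (rule integral_mono_AE[OF i0])
       (use i1 assms in \<open>auto simp: AE_measure_pmf_iff intro!: Bochner_Integration.integrable_add Bochner_Integration.integrable_sum\<close>)
  also have "\<dots> = measure_pmf.prob p B + (\<Sum>i\<in>I. c i * measure_pmf.prob p (D i))"
    by (subst Bochner_Integration.integral_add)
       (use i1 in \<open>auto intro!: Bochner_Integration.integrable_sum\<close>)
  finally show ?thesis .
qed

subsection \<open>Upper bounds for occupation probabilities\<close>

text \<open>Moves a union bound from the cluster after one step to the uniform walk that drives the
  step.\<close>

lemma prob_step_le:
  assumes "{0..<n} \<notin> C"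
    and "\<And>\<sigma>. \<sigma> \<in> permutations_of_set {0..<n} \<Longrightarrow> P (insert (landing n C \<sigma>) C) \<Longrightarrow> \<exists>i\<in>I. R i \<sigma>"
    and "finite I"
  shows "measure_pmf.prob (dla_step n C) {C'. P C'} \<le>
    (\<Sum>i\<in>I. measure_pmf.prob (pmf_of_set (permutations_of_set {0..<n})) {\<sigma>. R i \<sigma>})"
proof -
  let ?w = "pmf_of_set (permutations_of_set {0..<n})"
  have "measure_pmf.prob (dla_step n C) {C'. P C'} = measure_pmf.prob ?w {\<sigma>. P (insert (landing n C \<sigma>) C)}"
    using assms(1) by (simp add: dla_step_landing vimage_def)
  also have "\<dots> \<le> measure_pmf.prob ?w (\<Union>i\<in>I. {\<sigma>. R i \<sigma>})"
    using assms(2) by (intro measure_pmf.finite_measure_mono_AE) (auto simp: AE_measure_pmf_iff)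
  also have "\<dots> \<le> (\<Sum>i\<in>I. measure_pmf.prob ?w {\<sigma>. R i \<sigma>})"
    using assms(3) by (intro measure_pmf.finite_measure_subadditive_finite) auto
  finally show ?thesis .
qed

text \<open>A step adds a single vertex, so \<open>S\<close> becomes fully occupied only if exactly
  one \<open>x\<close> of \<open>S\<close> was missing and the walk crosses level \<open>j\<close>
  at that \<open>x\<close>.\<close>

lemma prob_subset_step_le:
  assumes C: "cluster n C" and S: "\<And>x. x \<in> S \<Longrightarrow> x \<subseteq> {0..<n} \<and> card x = j" "finite S"
  shows "measure_pmf.prob (dla_step n C) {C'. S \<subseteq> C'} \<le>
    indicator {C. S \<subseteq> C} C + (\<Sum>x\<in>S. 1 / real (n choose j) * indicator {C. S - {x} \<subseteq> C} C)"
proof (cases "S \<subseteq> C")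
  case True
  have "measure_pmf.prob (dla_step n C) {C'. S \<subseteq> C'} \<le> 1" by simp
  moreover have "0 \<le> (\<Sum>x\<in>S. 1 / real (n choose j) * indicator {C. S - {x} \<subseteq> C} C)"
    by (intro sum_nonneg) auto
  moreover have "indicator {C. S \<subseteq> C} C = (1 :: real)" using True by simp
  ultimately show ?thesis by linarith
next
  case False
  show ?thesis
  proof (cases "{0..<n} \<in> C")
    case True
    then show ?thesis using False
      by (simp add: dla_step_def sum_nonneg)
  next
    case n: False
    let ?I = "{x\<in>S. S - {x} \<subseteq> C}"
    have "measure_pmf.prob (dla_step n C) {C'. S \<subseteq> C'} \<le>
      (\<Sum>x\<in>?I. measure_pmf.prob (pmf_of_set (permutations_of_set {0..<n})) {\<sigma>. walk_vertex n \<sigma> (n - j) = x})"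
    proof (rule prob_step_le[OF n])
      fix \<sigma> assume s: "\<sigma> \<in> permutations_of_set {0..<n}" "S \<subseteq> insert (landing n C \<sigma>) C"
      have "landing n C \<sigma> \<in> ?I" using s(2) False by auto
      moreover have "walk_vertex n \<sigma> (n - j) = landing n C \<sigma>"
        using landing_eqD(4)[OF C n s(1) refl] calculation S by auto
      ultimately show "\<exists>x\<in>?I. walk_vertex n \<sigma> (n - j) = x" by blast
    qed (use S in auto)
    also have "\<dots> = (\<Sum>x\<in>?I. 1 / real (n choose j))"
      using S by (intro sum.cong prob_walk_through) auto
    also have "\<dots> = (\<Sum>x\<in>S. 1 / real (n choose j) * indicator {C. S - {x} \<subseteq> C} C)"
      using S(2) by (intro sum.mono_neutral_cong_left) auto
    finally show ?thesis by (simp add: indicator_def)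
  qed
qed

text \<open>The left side consists of the first two terms of the binomial expansion of the right
  side. With \<open>a = t / N\<close> and \<open>b = 1 / N\<close> this advances the time from
  \<open>t\<close> to \<open>t + 1\<close>.\<close>

lemma power_add_le_power_Suc:
  fixes a b :: real
  assumes "a \<ge> 0" "b \<ge> 0"
  shows "a ^ Suc s + real (Suc s) * (b * a ^ s) \<le> (a + b) ^ Suc s"
proof (induction s)
  case 0
  then show ?case by simp
next
  case (Suc s)
  have "(a + b) * (a ^ Suc s + real (Suc s) * (b * a ^ s)) \<le> (a + b) * (a + b) ^ Suc s"
    using Suc assms by (intro mult_left_mono) auto
  moreover have "(a + b) * (a ^ Suc s + real (Suc s) * (b * a ^ s)) =
     a ^ Suc (Suc s) + real (Suc (Suc s)) * (b * a ^ Suc s) + real (Suc s) * b\<^sup>2 * a ^ s"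
    by (simp add: algebra_simps power2_eq_square)
  moreover have "real (Suc s) * b\<^sup>2 * a ^ s \<ge> 0" using assms by simp
  ultimately show ?case by simp
qed

text \<open>Every walk passes level \<open>j\<close> at a uniformly distributed vertex, so the occupied part of that
  level is dominated by \<open>t\<close> independent uniform samples.\<close>

lemma prob_subset_dla_le:
  assumes "\<And>x. x \<in> S \<Longrightarrow> x \<subseteq> {0..<n} \<and> card x = j" "finite S" "j > 0"
  shows "measure_pmf.prob (dla n t) {C. S \<subseteq> C} \<le> (real t / real (n choose j)) ^ card S"
  using assms(1,2)
proof (induction t arbitrary: S)
  case 0
  \<comment> \<open>The initial cluster consists of the empty set only, which does not lie on a
    level \<open>j > 0\<close>.\<close>
  have "S = {}" if "S \<subseteq> {{}}" using 0(1) assms(3) that by force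
  then show ?case using 0
    by (auto simp: dla_def indicator_def)
next
  case (Suc t)
  let ?N = "real (n choose j)"
  show ?case
  proof (cases "S = {}")
    case True
    then show ?thesis by simp
  next
    case False
    then obtain s where s: "card S = Suc s" using Suc.prems(2) by (metis card_eq_0_iff not0_implies_Suc)
    have "measure_pmf.prob (dla n (Suc t)) {C. S \<subseteq> C} \<le>
      measure_pmf.prob (dla n t) {C. S \<subseteq> C} +
      (\<Sum>x\<in>S. 1 / ?N * measure_pmf.prob (dla n t) {C. S - {x} \<subseteq> C})"
      unfolding dla_Suc
      by (intro prob_bind_pmf_le prob_subset_step_le Suc.prems) (auto dest: cluster_dla)
    also have "\<dots> \<le> (real t / ?N) ^ card S + (\<Sum>x\<in>S. 1 / ?N * (real t / ?N) ^ s)"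
    proof (intro add_mono sum_mono mult_left_mono)
      fix x assume x: "x \<in> S"
      have "measure_pmf.prob (dla n t) {C. S - {x} \<subseteq> C} \<le> (real t / ?N) ^ card (S - {x})"
        using Suc.prems by (intro Suc.IH) auto
      then show "measure_pmf.prob (dla n t) {C. S - {x} \<subseteq> C} \<le> (real t / ?N) ^ s"
        using s x by (simp add: card_Diff_singleton)
    qed (use Suc in auto)
    also have "\<dots> = (real t / ?N) ^ Suc s + real (Suc s) * (1 / ?N * (real t / ?N) ^ s)"
      by (simp only: s sum_constant)
    also have "\<dots> \<le> (real t / ?N + 1 / ?N) ^ Suc s"
      by (rule power_add_le_power_Suc) auto
    also have "\<dots> = (real (Suc t) / ?N) ^ card S" by (simp only: s) (simp add: add_divide_distrib add.commute)
    finally show ?thesis .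
  qed
qed

text \<open>For \<open>x\<close> to become occupied, the walk has to traverse an edge from
  \<open>x\<close> to an occupied lower neighbour, and each such edge has probability
  \<open>1 / (j * (n choose j))\<close>.\<close>

lemma prob_mem_step_le:
  assumes C: "cluster n C" and x: "x \<subseteq> {0..<n}" "card x = j"
  shows "measure_pmf.prob (dla_step n C) {C'. x \<in> C'} \<le>
    indicator {C. x \<in> C} C + (\<Sum>a\<in>x. 1 / (real j * real (n choose j)) * indicator {C. x - {a} \<in> C} C)"
proof (cases "x \<in> C \<or> {0..<n} \<in> C")
  case True
  have "measure_pmf.prob (dla_step n C) {C'. x \<in> C'} \<le> indicator {C. x \<in> C} C"
    using True by (cases "x \<in> C") (auto simp: dla_step_def)
  moreover have "0 \<le> (\<Sum>a\<in>x. 1 / (real j * real (n choose j)) * indicator {C. x - {a} \<in> C} C)"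
    by (intro sum_nonneg) auto
  ultimately show ?thesis by simp
next
  case False
  then have n: "{0..<n} \<notin> C" by simp
  have fx: "finite x" using x finite_subset by auto
  let ?I = "{a\<in>x. x - {a} \<in> C}"
  have "measure_pmf.prob (dla_step n C) {C'. x \<in> C'} \<le>
    (\<Sum>a\<in>?I. measure_pmf.prob (pmf_of_set (permutations_of_set {0..<n}))
       {\<sigma>. walk_vertex n \<sigma> (n - j) = x \<and> \<sigma> ! (n - j) = a})"
  proof (rule prob_step_le[OF n])
    fix \<sigma> assume s: "\<sigma> \<in> permutations_of_set {0..<n}" "x \<in> insert (landing n C \<sigma>) C"
    then have "landing n C \<sigma> = x" using False by auto
    from landing_eqD[OF C n s(1) this] x
    show "\<exists>a\<in>?I. walk_vertex n \<sigma> (n - j) = x \<and> \<sigma> ! (n - j) = a" by auto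
  qed (use fx in auto)
  also have "\<dots> = (\<Sum>a\<in>?I. 1 / (real j * real (n choose j)))"
    using x by (intro sum.cong prob_walk_through_edge) auto
  also have "\<dots> = (\<Sum>a\<in>x. 1 / (real j * real (n choose j)) * indicator {C. x - {a} \<in> C} C)"
    using fx by (intro sum.mono_neutral_cong_left) auto
  finally show ?thesis by (simp add: indicator_def)
qed

text \<open>To be occupied, a vertex needs an occupied lower neighbour first; summing the waiting times along
  the levels gives one factor \<open>T / (n choose i)\<close> per level.\<close>

lemma prob_mem_dla_le:
  assumes "x \<subseteq> {0..<n}" "card x = j" "t \<le> T"
  shows "measure_pmf.prob (dla n t) {C. x \<in> C} \<le> real T ^ j / (\<Prod>i=1..j. real (n choose i))"
proof -
  \<comment> \<open>The induction keeps one factor \<open>t\<close> in place of \<open>T\<close>,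
    because the bound must grow linearly in time. Level 0 is separate: its vertex is occupied from
    the start.\<close>
  have "measure_pmf.prob (dla n t) {C. x \<in> C} \<le>
      (if j = 0 then 1 else real t * real T ^ (j - 1) / (\<Prod>i=1..j. real (n choose i)))"
    using assms
  proof (induction t arbitrary: x j)
    case 0
    have "finite x" using 0 finite_subset by auto
    then show ?case using 0
      by (auto simp: dla_def indicator_def)
  next
    case (Suc t)
    let ?N = "real (n choose j)"
    have fx: "finite x" using finite_subset[OF Suc.prems(1)] by simp
    show ?case
    proof (cases j)
      case 0
      then show ?thesis by simp
    next
      case (Suc i)
      let ?b = "real T ^ i / (\<Prod>i=1..i. real (n choose i))"
      have tT: "t \<le> T" using Suc.prems by simp
      have "measure_pmf.prob (dla n (Suc t)) {C. x \<in> C} \<le>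
        measure_pmf.prob (dla n t) {C. x \<in> C} +
        (\<Sum>a\<in>x. 1 / (real j * ?N) * measure_pmf.prob (dla n t) {C. x - {a} \<in> C})"
        unfolding dla_Suc
        by (intro prob_bind_pmf_le prob_mem_step_le Suc.prems) (auto dest: cluster_dla)
      also have "\<dots> \<le> real t * real T ^ i / (\<Prod>i=1..j. real (n choose i)) +
          (\<Sum>a\<in>x. 1 / (real j * ?N) * ?b)"
      proof (intro add_mono sum_mono mult_left_mono)
        show "measure_pmf.prob (dla n t) {C. x \<in> C} \<le> real t * real T ^ i / (\<Prod>i=1..j. real (n choose i))"
          using Suc.IH[OF Suc.prems(1,2) tT] Suc by simp
      next
        fix a assume a: "a \<in> x"
        have "card (x - {a}) = i" using a Suc Suc.prems by simp
        then have "measure_pmf.prob (dla n t) {C. x - {a} \<in> C} \<le>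
          (if i = 0 then 1 else real t * real T ^ (i - 1) / (\<Prod>i=1..i. real (n choose i)))"
          using Suc.prems(1) by (intro Suc.IH[OF _ _ tT]) auto
        also have "\<dots> \<le> ?b"
        proof (cases i)
          case (Suc i')
          have "real t * real T ^ i' \<le> real T * real T ^ i'"
            using tT by (intro mult_right_mono) auto
          then have "real t * real T ^ i' / (\<Prod>i=1..i. real (n choose i)) \<le>
             real T * real T ^ i' / (\<Prod>i=1..i. real (n choose i))"
            by (intro divide_right_mono prod_nonneg) auto
          then show ?thesis using Suc by simp
        qed simp
        finally show "measure_pmf.prob (dla n t) {C. x - {a} \<in> C} \<le> ?b" .
      qed auto
      \<comment> \<open>The \<open>j\<close> lower neighbours cancel the factor \<open>1 / j\<close>
        of the edge probability.\<close>
      also have "(\<Sum>a\<in>x. 1 / (real j * ?N) * ?b) = ?b / ?N"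
        using Suc Suc.prems by simp
      also have "\<dots> = real T ^ i / (\<Prod>i=1..j. real (n choose i))"
        using Suc by (simp add: mult.commute)
      finally show ?thesis using Suc by (simp add: add_divide_distrib algebra_simps)
    qed
  qed
  also have "\<dots> \<le> real T ^ j / (\<Prod>i=1..j. real (n choose i))"
  proof (cases j)
    case (Suc i)
    have "real t * real T ^ i \<le> real T * real T ^ i"
      using assms(3) by (intro mult_right_mono) auto
    then have "real t * real T ^ i / (\<Prod>i=1..j. real (n choose i)) \<le>
       real T * real T ^ i / (\<Prod>i=1..j. real (n choose i))"
      by (intro divide_right_mono prod_nonneg) auto
    then show ?thesis using Suc by simp
  qed simp
  finally show ?thesis .
qed

subsection \<open>Filling a level\<close>

text \<open>The thresholds \<open>2 ^ -(i + 1)\<close> sum to at most \<open>1 / 2\<close>, so at most half of the walks through \<open>v\<close>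
  are absorbed above \<open>v\<close>.\<close>

definition sparse_above :: "nat \<Rightarrow> nat set set \<Rightarrow> nat set \<Rightarrow> bool" where
  "sparse_above n C v \<longleftrightarrow>
     (\<forall>i\<ge>1. real (card {y \<in> C. v \<subseteq> y \<and> card y = card v + i}) \<le> real ((n - card v) choose i) / 2 ^ (i + 1))"

lemma sparse_above_antimono:
  assumes "sparse_above n C' v" "C \<subseteq> C'" "finite C'"
  shows "sparse_above n C v"
  unfolding sparse_above_def
proof (intro allI impI)
  fix i :: nat assume i: "1 \<le> i"
  have "card {y \<in> C. v \<subseteq> y \<and> card y = card v + i} \<le> card {y \<in> C'. v \<subseteq> y \<and> card y = card v + i}"
    using assms(2,3) by (intro card_mono) auto
  moreover have "real (card {y \<in> C'. v \<subseteq> y \<and> card y = card v + i}) \<le> real ((n - card v) choose i) / 2 ^ (i + 1)"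
    using assms(1) i unfolding sparse_above_def by blast
  ultimately show "real (card {y \<in> C. v \<subseteq> y \<and> card y = card v + i}) \<le> real ((n - card v) choose i) / 2 ^ (i + 1)"
    by linarith
qed

text \<open>At distance \<open>n - card v\<close> above \<open>v\<close> there is only the top
  vertex, and the threshold there is below 1. Sparseness thus implies that the process has not
  terminated.\<close>

lemma sparse_above_top_notin:
  assumes "sparse_above n C v" "finite C" "v \<subseteq> {0..<n}" "card v < n"
  shows "{0..<n} \<notin> C"
proof
  assume "{0..<n} \<in> C"
  let ?i = "n - card v"
  define Z where "Z = {y \<in> C. v \<subseteq> y \<and> card y = card v + ?i}"
  have "{0..<n} \<in> Z" using \<open>{0..<n} \<in> C\<close> assms by (simp add: Z_def)
  moreover have "finite Z" using assms(2) by (simp add: Z_def)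
  ultimately have "card Z \<ge> 1" by (simp add: Suc_le_eq card_gt_0_iff) blast
  moreover have "?i \<ge> 1" using assms(4) by simp
  then have "real (card Z) \<le> real (?i choose ?i) / 2 ^ (?i + 1)"
    using assms(1) unfolding sparse_above_def Z_def by blast
  moreover have "real (?i choose ?i) / 2 ^ (?i + 1) < 1"
    using one_less_power[of "2 :: real" "?i + 1"] by (simp add: divide_less_eq)
  ultimately show False by linarith
qed

lemma sum_half_powers_le: "(\<Sum>i=1..m. 1 / 2 ^ (i + 1) :: real) \<le> 1 / 2"
proof -
  have "(\<Sum>i=1..m. 1 / 2 ^ (i + 1) :: real) = 1 / 2 - 1 / 2 ^ (m + 1)"
    by (induction m) (auto simp: field_simps)
  then show ?thesis by simp
qed

text \<open>A walk from the top to \<open>v\<close> visits a uniform vertex at distance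
  \<open>i\<close> above \<open>v\<close>. By sparseness that vertex is occupied with probability at
  most \<open>1 / 2 ^ (i + 1)\<close>, and a union bound over \<open>i\<close> leaves at least half
  of the walks unblocked.\<close>

lemma card_unblocked_ge:
  assumes C: "finite C" "C \<subseteq> Pow {0..<n}" and v: "v \<subseteq> {0..<n}" "card v = k" and sp: "sparse_above n C v"
  shows "2 * real (card {\<alpha> \<in> permutations_of_set ({0..<n} - v). \<forall>i<n-k. {0..<n} - set (take i \<alpha>) \<notin> C})
     \<ge> fact (n - k)"
proof -
  let ?A = "{0..<n} - v"
  let ?P = "permutations_of_set ?A"
  let ?U = "{\<alpha> \<in> ?P. \<forall>i<n-k. {0..<n} - set (take i \<alpha>) \<notin> C}"
  let ?B = "{\<alpha> \<in> ?P. \<not> (\<forall>i<n-k. {0..<n} - set (take i \<alpha>) \<notin> C)}"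
  let ?Y = "\<lambda>i. {y \<in> C. v \<subseteq> y \<and> card y = k + i}"
  let ?thr = "\<lambda>y. {\<alpha> \<in> ?P. set (take (n - card y) \<alpha>) = {0..<n} - y}"
  have fv: "finite v" using v finite_subset by auto
  have kn: "k \<le> n" using v card_mono[of "{0..<n}" v] by simp
  have cA: "card ?A = n - k" using v fv by (simp add: card_Diff_subset)
  \<comment> \<open>Blocked walks are sorted by the occupied vertex \<open>y\<close> that they meet
    and its distance \<open>i\<close> above \<open>v\<close>. Index \<open>n - k\<close> is left out
    since it is \<open>v\<close> itself.\<close>
  have sub: "?B \<subseteq> (\<Union>i\<in>{1..n-k}. \<Union>y\<in>?Y i. ?thr y)"
  proof
    fix \<alpha> assume "\<alpha> \<in> ?B"
    then obtain i where a: "\<alpha> \<in> ?P" "i < n - k" "{0..<n} - set (take i \<alpha>) \<in> C" by auto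
    let ?y = "{0..<n} - set (take i \<alpha>)"
    have d: "distinct \<alpha>" "set \<alpha> = ?A" using a by (auto simp: permutations_of_set_def)
    then have l: "length \<alpha> = n - k" using cA distinct_card[of \<alpha>] by simp
    have ss: "set (take i \<alpha>) \<subseteq> ?A" using d set_take_subset by metis
    have ct: "card (set (take i \<alpha>)) = i" using d l a by (simp add: distinct_card)
    have "set (take i \<alpha>) \<subseteq> {0..<n}" using ss by auto
    then have cy: "card ?y = n - i" using ct by (simp add: card_Diff_subset)
    have vy: "v \<subseteq> ?y" using ss v by auto
    have "?y \<in> ?Y (n - i - k)" using a vy cy by auto
    moreover have "\<alpha> \<in> ?thr ?y" using a cy ss by auto
    moreover have "n - i - k \<in> {1..n-k}" using a by auto
    ultimately show "\<alpha> \<in> (\<Union>i\<in>{1..n-k}. \<Union>y\<in>?Y i. ?thr y)" by blast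
  qed
  have thr: "card (?thr y) = fact (n - k - i) * fact i" if y: "y \<in> ?Y i" "i \<in> {1..n-k}" for y i
  proof -
    have yn: "y \<subseteq> {0..<n}" using y C by auto
    then have c: "card ({0..<n} - y) = n - (k + i)" using y
      by (simp add: card_Diff_subset finite_subset)
    have "{0..<n} - y \<subseteq> ?A" using y by auto
    then have "card {\<alpha> \<in> ?P. set (take (n - (k + i)) \<alpha>) = {0..<n} - y} = fact (n - (k + i)) * fact (n - k - (n - (k + i)))"
      using card_permutations_of_set_prefix[of ?A "{0..<n} - y"] unfolding c cA by simp
    moreover have "n - k - (n - (k + i)) = i" using y(2) by auto
    moreover have "card y = k + i" using y(1) by simp
    ultimately show ?thesis by (simp only: diff_diff_left)
  qed
  have "real (card ?B) \<le> real (card (\<Union>i\<in>{1..n-k}. \<Union>y\<in>?Y i. ?thr y))"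
    by (intro of_nat_mono card_mono sub) (use C in auto)
  also have "\<dots> \<le> real (\<Sum>i=1..n-k. \<Sum>y\<in>?Y i. card (?thr y))"
    using C by (intro of_nat_mono order.trans[OF card_UN_le] sum_mono card_UN_le) auto
  also have "\<dots> = (\<Sum>i=1..n-k. real (card (?Y i)) * (fact (n - k - i) * fact i))"
    using thr by simp
  also have "\<dots> \<le> (\<Sum>i=1..n-k. real ((n - k) choose i) / 2 ^ (i + 1) * (fact (n - k - i) * fact i))"
    using sp v by (intro sum_mono mult_right_mono) (auto simp: sparse_above_def)
  \<comment> \<open>The number of walks through each \<open>y\<close> cancels the binomial
    coefficient of the threshold.\<close>
  also have "\<dots> = (\<Sum>i=1..n-k. 1 / 2 ^ (i + 1) * fact (n - k))"
  proof (intro sum.cong refl)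
    fix i assume "i \<in> {1..n-k}"
    then have "real ((n - k) choose i) * (fact (n - k - i) * fact i) = fact (n - k)"
      using binomial_fact_lemma[of i "n - k"] by (metis atLeastAtMost_iff mult.commute of_nat_fact of_nat_mult)
    then show "real ((n - k) choose i) / 2 ^ (i + 1) * (fact (n - k - i) * fact i) = 1 / 2 ^ (i + 1) * fact (n - k)"
      by (metis (no_types, lifting) mult_1 times_divide_eq_left)
  qed
  also have "\<dots> = (\<Sum>i=1..n-k. 1 / 2 ^ (i + 1)) * fact (n - k)"
    by (rule sum_distrib_right[symmetric])
  also have "\<dots> \<le> 1 / 2 * fact (n - k)"
    by (intro mult_right_mono sum_half_powers_le) auto
  finally have B: "real (card ?B) \<le> 1 / 2 * fact (n - k)" .
  have "card ?P = card (?U \<union> ?B)" by (rule arg_cong[where f = card]) auto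
  also have "\<dots> = card ?U + card ?B" by (rule card_Un_disjoint) auto
  finally have "card ?U + card ?B = fact (n - k)" using cA by simp
  then have "real (card ?U + card ?B) = real (fact (n - k))" by (rule arg_cong)
  then have "real (card ?U) + real (card ?B) = fact (n - k)" by (simp only: of_nat_add of_nat_fact)
  then show ?thesis using B by linarith
qed

text \<open>The walk meets \<open>v\<close> with probability \<open>1 / (n choose k)\<close>. Given
  this, it arrives unblocked with probability at least 1/2 and, independently, steps on to an
  occupied neighbour with probability at least 1/2.\<close>

lemma prob_landing_ge:
  assumes C: "cluster n C" and v: "v \<subseteq> {0..<n}" "card v = k" "k > 0" "v \<notin> C"
    and sp: "sparse_above n C v" and down: "2 * card {a \<in> v. v - {a} \<in> C} \<ge> k"
  shows "measure_pmf.prob (pmf_of_set (permutations_of_set {0..<n})) {\<sigma>. landing n C \<sigma> = v} \<ge>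
    1 / (4 * real (n choose k))"
proof -
  let ?B = "{a \<in> v. v - {a} \<in> C}"
  let ?U = "{\<alpha> \<in> permutations_of_set ({0..<n} - v). \<forall>i<n-k. {0..<n} - set (take i \<alpha>) \<notin> C}"
  let ?G = "{\<sigma> \<in> permutations_of_set {0..<n}. walk_vertex n \<sigma> (n - k) = v \<and>
     (\<forall>i<n-k. {0..<n} - set (take i (take (n - k) \<sigma>)) \<notin> C) \<and> drop (n - k) \<sigma> ! 0 \<in> ?B}"
  have fv: "finite v" using v finite_subset by auto
  have kn: "k \<le> n" using v card_mono[of "{0..<n}" v] by simp
  have "card ?G = card ?U * (card ?B * fact (k - 1))"
    using card_walks_through[OF v(1,2), of "\<lambda>\<alpha>. \<forall>i<n-k. {0..<n} - set (take i \<alpha>) \<notin> C" "\<lambda>\<beta>. \<beta> ! 0 \<in> ?B"]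
      card_permutations_of_set_nth_0_in[of v ?B] fv v by simp
  then have "4 * real (card ?G) = (2 * real (card ?U)) * (real (2 * card ?B) * fact (k - 1))"
    by simp
  also have "\<dots> \<ge> fact (n - k) * (real k * fact (k - 1))"
  proof (intro mult_mono)
    show "fact (n - k) \<le> 2 * real (card ?U)"
      using card_unblocked_ge[of C n v k] C cluster_finite[OF C] v sp by (auto simp: cluster_def)
    show "real k \<le> real (2 * card ?B)" using down of_nat_mono by blast
  qed auto
  also have "real k * fact (k - 1) = fact k" using v(3) by (simp add: fact_reduce)
  finally have 1: "real (fact (n - k) * fact k) \<le> 4 * real (card ?G)" by simp
  have sub: "?G \<subseteq> {\<sigma> \<in> permutations_of_set {0..<n}. landing n C \<sigma> = v}"
  proof
    fix \<sigma> assume s: "\<sigma> \<in> ?G"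
    then have p: "\<sigma> \<in> permutations_of_set {0..<n}" by simp
    have l: "length \<sigma> = n" using permutations_upt_D[OF p] by simp
    have "landing n C \<sigma> = v"
    proof (rule landing_eqI[OF p v(2,3) kn])
      show "walk_vertex n \<sigma> (n - k) = v" using s by simp
      show "v - {\<sigma> ! (n - k)} \<in> C" using s l by simp
      fix i assume i: "i \<le> n - k"
      show "walk_vertex n \<sigma> i \<notin> C"
      proof (cases "i = n - k")
        case True
        then show ?thesis using s v by simp
      next
        case False
        then have "i < n - k" using i by simp
        then have "{0..<n} - set (take i (take (n - k) \<sigma>)) \<notin> C" using s by blast
        then show ?thesis using i by (simp add: walk_vertex_def min_absorb1)
      qed
    qed
    then show "\<sigma> \<in> {\<sigma> \<in> permutations_of_set {0..<n}. landing n C \<sigma> = v}" using p by simp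
  qed
  have "1 / (4 * real (n choose k)) = real (fact (n - k) * fact k) / fact n / 4"
    using fact_mult_over_fact[OF kn] by simp
  also have "\<dots> \<le> 4 * real (card ?G) / fact n / 4"
    using 1 by (intro divide_right_mono) auto
  also have "\<dots> \<le> real (card {\<sigma> \<in> permutations_of_set {0..<n}. landing n C \<sigma> = v}) / fact n"
    using card_mono[OF _ sub] by (simp add: divide_right_mono)
  finally show ?thesis by (simp only: prob_walk)
qed

text \<open>A walk lands at one vertex only, so the landing events for distinct members of
  \<open>S\<close> are disjoint and their lower bounds add up.\<close>

lemma prob_step_avoid_le:
  assumes C: "cluster n C" and "k > 0" "k < n" and fin: "finite S"
    and S: "\<And>v. v \<in> S \<Longrightarrow> v \<subseteq> {0..<n} \<and> card v = k \<and> v \<notin> C \<and> sparse_above n C v \<and>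
          2 * card {a \<in> v. v - {a} \<in> C} \<ge> k"
  shows "measure_pmf.prob (dla_step n C) {C'. S \<inter> C' = {}} \<le> 1 - real (card S) / (4 * real (n choose k))"
proof (cases "S = {}")
  case True
  then show ?thesis by simp
next
  case False
  let ?w = "pmf_of_set (permutations_of_set {0..<n})"
  from False obtain v where "v \<in> S" by auto
  then have n: "{0..<n} \<notin> C"
    using S[of v] sparse_above_top_notin[of n C v] assms(3) cluster_finite[OF C] by auto
  have "real (card S) / (4 * real (n choose k)) = (\<Sum>v\<in>S. 1 / (4 * real (n choose k)))" by simp
  also have "\<dots> \<le> (\<Sum>v\<in>S. measure_pmf.prob ?w {\<sigma>. landing n C \<sigma> = v})"
    using S assms(2) by (intro sum_mono prob_landing_ge[OF C]) auto
  also have "\<dots> = measure_pmf.prob ?w (\<Union>v\<in>S. {\<sigma>. landing n C \<sigma> = v})"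
    using fin by (intro measure_pmf.finite_measure_finite_Union[symmetric]) (auto simp: disjoint_family_on_def)
  also have "(\<Union>v\<in>S. {\<sigma>. landing n C \<sigma> = v}) = {\<sigma>. landing n C \<sigma> \<in> S}" by auto
  finally have 1: "real (card S) / (4 * real (n choose k)) \<le> measure_pmf.prob ?w {\<sigma>. landing n C \<sigma> \<in> S}" .
  have "{\<sigma>. S \<inter> insert (landing n C \<sigma>) C = {}} = UNIV - {\<sigma>. landing n C \<sigma> \<in> S}"
    using S by auto
  then have "measure_pmf.prob (dla_step n C) {C'. S \<inter> C' = {}} = 1 - measure_pmf.prob ?w {\<sigma>. landing n C \<sigma> \<in> S}"
    using n measure_pmf.prob_compl[of "{\<sigma>. landing n C \<sigma> \<in> S}" ?w]
    by (simp add: dla_step_landing vimage_def)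
  then show ?thesis using 1 by linarith
qed

text \<open>Clusters only grow. If \<open>S\<close> is unoccupied and the cluster sparse above it at
  the end, the same holds at every earlier time, while the supply of occupied lower neighbours never
  shrinks. Hence each of the \<open>t\<close> steps contributes a factor
  \<open>1 - r\<close>.\<close>

lemma prob_dla_from_avoid_le:
  assumes C: "cluster n C" and "k > 0" "k < n" and fin: "finite S"
    and S: "\<And>v. v \<in> S \<Longrightarrow> v \<subseteq> {0..<n} \<and> card v = k \<and> 2 * card {a \<in> v. v - {a} \<in> C} \<ge> k"
    and r: "r = real (card S) / (4 * real (n choose k))" "r \<le> 1"
  shows "measure_pmf.prob (dla_from n t C) {C'. S \<inter> C' = {} \<and> (\<forall>v\<in>S. sparse_above n C' v)} \<le> (1 - r) ^ t"
  using C S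
proof (induction t arbitrary: C)
  case 0
  then show ?case by simp
next
  case (Suc t)
  let ?E = "{C'. S \<inter> C' = {} \<and> (\<forall>v\<in>S. sparse_above n C' v)}"
  show ?case
  proof (cases "C \<in> ?E")
    case False
    \<comment> \<open>Both conditions in \<open>?E\<close> pass to smaller clusters, so once
      violated they stay violated.\<close>
    have "C' \<notin> ?E" if "C' \<in> set_pmf (dla_from n (Suc t) C)" for C'
    proof -
      note c = cluster_dla_from[OF Suc.prems(1) that]
      show ?thesis
        using False c(2) sparse_above_antimono[OF _ c(2) cluster_finite[OF c(1)]] by auto
    qed
    then have "measure_pmf.prob (dla_from n (Suc t) C) ?E = 0"
      by (subst measure_pmf_zero_iff) auto
    then show ?thesis using r by simp
  next
    case True
    have "measure_pmf.prob (bind_pmf (dla_step n C) (dla_from n t)) ?E \<le>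
      measure_pmf.prob (dla_step n C) {} + (\<Sum>i\<in>{()}. (1 - r) ^ t * measure_pmf.prob (dla_step n C) {C'. S \<inter> C' = {}})"
    proof (rule prob_bind_pmf_le)
      fix C' assume C': "C' \<in> set_pmf (dla_step n C)"
      note c = cluster_step[OF Suc.prems(1) C']
      show "measure_pmf.prob (dla_from n t C') ?E \<le>
        indicator {} C' + (\<Sum>i\<in>{()}. (1 - r) ^ t * indicator {C'. S \<inter> C' = {}} C')"
      proof (cases "S \<inter> C' = {}")
        case True
        have "measure_pmf.prob (dla_from n t C') ?E \<le> (1 - r) ^ t"
        proof (rule Suc.IH[OF c(1)])
          fix v assume v: "v \<in> S"
          have "finite v" using Suc.prems(2)[OF v] finite_subset[of v "{0..<n}"] by simp
          then have "card {a \<in> v. v - {a} \<in> C} \<le> card {a \<in> v. v - {a} \<in> C'}"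
            using c(2) by (intro card_mono) auto
          then show "v \<subseteq> {0..<n} \<and> card v = k \<and> 2 * card {a \<in> v. v - {a} \<in> C'} \<ge> k"
            using Suc.prems(2)[OF v] by linarith
        qed
        then show ?thesis using True by simp
      next
        case False
        have "D \<notin> ?E" if "D \<in> set_pmf (dla_from n t C')" for D
          using cluster_dla_from[OF c(1) that] False by auto
        then have "measure_pmf.prob (dla_from n t C') ?E = 0"
          by (subst measure_pmf_zero_iff) blast
        then show ?thesis using r by simp
      qed
    qed
    also have "\<dots> = (1 - r) ^ t * measure_pmf.prob (dla_step n C) {C'. S \<inter> C' = {}}" by simp
    also have "\<dots> \<le> (1 - r) ^ t * (1 - r)"
      unfolding r(1)
    proof (intro mult_left_mono prob_step_avoid_le[OF Suc.prems(1) assms(2,3) fin])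
      fix v assume "v \<in> S"
      then show "v \<subseteq> {0..<n} \<and> card v = k \<and> v \<notin> C \<and> sparse_above n C v \<and>
          2 * card {a \<in> v. v - {a} \<in> C} \<ge> k" using True Suc.prems(2) by auto
    qed (use r in auto)
    finally show ?thesis by (simp add: dla_from_Suc' mult.commute)
  qed
qed

subsection \<open>Binomial estimates\<close>

text \<open>One term of the exponential series gives
  \<open>s ^ s / fact s \<le> exp s \<le> 3 ^ s\<close>; combine this with
  \<open>(m choose s) * fact s \<le> m ^ s\<close>.\<close>

lemma choose_le_three_power:
  assumes "s > 0"
  shows "real (m choose s) \<le> (3 * real m / real s) ^ s"
proof -
  have "inverse (fact s) * real s ^ s \<le> (\<Sum>k. inverse (fact k) * real s ^ k)"
    using sum_le_suminf[OF summable_exp[of "real s"], of "{s}"] by simp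
  also have "\<dots> = exp (real s)" by (simp add: exp_def)
  also have "\<dots> = exp 1 ^ s" by (simp add: exp_of_nat_mult[symmetric])
  also have "\<dots> \<le> 3 ^ s" using exp_le by (intro power_mono) auto
  finally have "real s ^ s \<le> 3 ^ s * fact s" by (simp add: field_simps)
  then have "real (m choose s) * real s ^ s \<le> real (m choose s) * (3 ^ s * fact s)"
    by (intro mult_left_mono) auto
  also have "\<dots> = 3 ^ s * real ((m choose s) * fact s)" by simp
  also have "\<dots> \<le> 3 ^ s * real (m ^ s)"
    using binomial_fact_pow[of m s] by (intro mult_left_mono of_nat_mono) auto
  finally have "real (m choose s) * real s ^ s \<le> (3 * real m) ^ s" by (simp add: power_mult_distrib)
  then show ?thesis using assms by (simp add: power_divide pos_le_divide_eq)
qed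

lemma choose_Suc_ge:
  assumes "q * Suc i \<le> n - i"
  shows "q * (n choose i) \<le> n choose Suc i"
proof -
  have "Suc i * (n choose Suc i) = (n - i) * (n choose i)"
    by (metis binomial_absorb_comp binomial_absorption)
  also have "\<dots> \<ge> q * Suc i * (n choose i)" using assms by (rule mult_le_mono1)
  finally have "Suc i * (q * (n choose i)) \<le> Suc i * (n choose Suc i)" by (simp only: mult_ac)
  then show ?thesis by (simp only: Suc_mult_le_cancel1)
qed

text \<open>Up to level \<open>n / 5\<close> consecutive binomial coefficients grow by a factor of
  at least 4.\<close>

lemma choose_mult_4_power_le:
  assumes "j \<le> i" "5 * i \<le> n"
  shows "4 ^ (i - j) * (n choose j) \<le> n choose i"
  using assms
proof (induction i rule: dec_induct)
  case base
  then show ?case by simp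
next
  case (step i)
  have "4 ^ (Suc i - j) * (n choose j) = 4 * (4 ^ (i - j) * (n choose j))"
    using step by (simp add: Suc_diff_le)
  also have "\<dots> \<le> 4 * (n choose i)" using step by simp
  also have "\<dots> \<le> n choose Suc i" using step by (intro choose_Suc_ge) auto
  finally show ?case .
qed

lemma mult_2_power_le_choose:
  assumes "1 \<le> i" "3 * i \<le> n"
  shows "2 ^ i * n \<le> 2 * (n choose i)"
  using assms
proof (induction i rule: dec_induct)
  case base
  then show ?case by simp
next
  case (step i)
  have IH: "2 ^ i * n \<le> 2 * (n choose i)" using step by simp
  have "2 ^ Suc i * n = 2 * (2 ^ i * n)" by simp
  also have "\<dots> \<le> 2 * (2 * (n choose i))" by (rule mult_le_mono2[OF IH])
  also have "\<dots> \<le> 2 * (n choose Suc i)" using step choose_Suc_ge[of 2 i n] by simp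
  finally show ?case .
qed

text \<open>The left side is one term of the expansion of \<open>(l + 1) ^ n\<close>.\<close>

lemma choose_mult_power_le_exp:
  fixes l :: real
  assumes "l \<ge> 0"
  shows "real (n choose k) * l ^ k \<le> exp (l * real n)"
proof (cases "k \<le> n")
  case True
  have "real (n choose k) * l ^ k \<le> (\<Sum>i\<le>n. real (n choose i) * l ^ i)"
    using assms True by (intro member_le_sum) auto
  also have "\<dots> = (l + 1) ^ n" by (subst binomial_ring) simp
  also have "\<dots> \<le> exp l ^ n" using assms by (intro power_mono) (auto simp: add.commute)
  also have "\<dots> = exp (l * real n)" by (simp add: exp_of_nat_mult[symmetric] mult.commute)
  finally show ?thesis .
qed (simp add: binomial_eq_0)

text \<open>The tangent of the logarithm at \<open>2 ^ 12\<close>, with \<open>ln 2\<close> rounded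
  up to 1. The far tangent point keeps the slope small.\<close>

lemma ln_le_div_4096:
  assumes "z > 0"
  shows "ln z \<le> z / 4096 + (11 :: real)"
proof -
  have "ln z = ln (z / 4096) + ln (2 ^ 12)" using assms by (simp add: ln_div)
  also have "ln (z / 4096) \<le> z / 4096 - 1" using assms by (intro ln_le_minus_one) auto
  also have "ln (2 ^ 12 :: real) = 12 * ln 2" by (subst ln_realpow) auto
  also have "ln 2 \<le> (1 :: real)" using ln_2_less_1 by simp
  finally show ?thesis by simp
qed

lemma choose_mult_2_power_le_exp:
  fixes \<epsilon> :: real
  assumes "0 < \<epsilon>" "\<epsilon> \<le> 1/100" "real j \<le> 2 * \<epsilon> ^ 3 * real n"
  shows "2 ^ j * real (n choose j) \<le> exp (\<epsilon> * real n / 100)"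
proof -
  \<comment> \<open>With this tilt \<open>l * n\<close> is at most
    \<open>\<epsilon> * n / 400\<close>, while \<open>2 / l = 8 / \<epsilon>\<^sup>2\<close> enters
    only through its logarithm, multiplied by \<open>j \<le> 2 * \<epsilon> ^ 3 * n\<close>.\<close>
  define l where "l = \<epsilon>\<^sup>2 / 4"
  have l: "l > 0" using assms by (simp add: l_def)
  have ll: "2 / l = 8 / \<epsilon>\<^sup>2" by (simp add: l_def)
  have e2: "\<epsilon>\<^sup>2 \<le> 1 / 10000" using power_mono[OF assms(2), of 2] assms(1) by (simp add: power2_eq_square)
  have lnn: "ln (2 / l) \<ge> 0" using l e2 assms unfolding ll by (intro ln_ge_zero) (simp add: divide_simps)
  have "2 ^ j * real (n choose j) = real (n choose j) * l ^ j * (2 / l) ^ j"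
    using l by (simp add: field_simps)
  also have "\<dots> \<le> exp (l * real n) * (2 / l) ^ j"
    using l by (intro mult_right_mono choose_mult_power_le_exp) auto
  also have "(2 / l) ^ j = exp (real j * ln (2 / l))"
    using l by (simp add: exp_of_nat_mult)
  also have "exp (l * real n) * \<dots> = exp (l * real n + real j * ln (2 / l))" by (simp add: exp_add)
  also have "\<dots> \<le> exp (\<epsilon> * real n / 100)"
  proof -
    have "real j * ln (2 / l) \<le> 2 * \<epsilon> ^ 3 * real n * ln (2 / l)"
      using assms(3) lnn by (intro mult_right_mono) auto
    also have "\<dots> \<le> 2 * \<epsilon> ^ 3 * real n * (8 / \<epsilon>\<^sup>2 / 4096 + 11)"
      unfolding ll using assms(1) by (intro mult_left_mono ln_le_div_4096) auto
    also have "\<dots> = \<epsilon> * real n * (1 / 256 + 22 * \<epsilon>\<^sup>2)"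
      using assms(1) by (simp add: field_simps power2_eq_square power3_eq_cube)
    finally have "l * real n + real j * ln (2 / l) \<le> l * real n + \<epsilon> * real n * (1 / 256 + 22 * \<epsilon>\<^sup>2)" by simp
    also have "\<dots> = \<epsilon> * real n * (\<epsilon> / 4 + (1 / 256 + 22 * \<epsilon>\<^sup>2))"
      by (simp add: l_def algebra_simps power2_eq_square)
    also have "\<dots> \<le> \<epsilon> * real n * (1 / 100)"
      using assms e2 by (intro mult_left_mono) auto
    finally show ?thesis by simp
  qed
  finally show ?thesis .
qed

section \<open>Sparseness of the cluster above the vertices of a level\<close>

lemma card_up_set:
  assumes "v \<subseteq> {0..<n}" "card v = k"
  shows "card {y. y \<subseteq> {0..<n} \<and> v \<subseteq> y \<and> card y = k + i} = (n - k) choose i"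
proof -
  have fv: "finite v" using assms finite_subset by auto
  let ?A = "{0..<n} - v"
  have "bij_betw (\<lambda>z. v \<union> z) {z. z \<subseteq> ?A \<and> card z = i} {y. y \<subseteq> {0..<n} \<and> v \<subseteq> y \<and> card y = k + i}"
  proof (rule bij_betw_byWitness[where f' = "\<lambda>y. y - v"], goal_cases)
    case 3
    show ?case
    proof safe
      fix z assume z: "z \<subseteq> ?A"
      then have "finite z" "v \<inter> z = {}" using finite_subset by auto
      then show "card (v \<union> z) = k + card z" using fv assms by (simp add: card_Un_disjoint)
    qed (use assms in auto)
  next
    case 4
    show ?case
    proof safe
      fix y assume y: "v \<subseteq> y" "card y = k + i"
      then show "card (y - v) = i" using fv assms by (simp add: card_Diff_subset)
    qed auto
  qed auto
  then have "card {z. z \<subseteq> ?A \<and> card z = i} = card {y. y \<subseteq> {0..<n} \<and> v \<subseteq> y \<and> card y = k + i}"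
    by (rule bij_betw_same_card)
  moreover have "card {z. z \<subseteq> ?A \<and> card z = i} = (n - k) choose i"
    using assms fv by (subst n_subsets) (auto simp: card_Diff_subset)
  ultimately show ?thesis by simp
qed

text \<open>Exceeding the threshold forces some \<open>s\<close>-element subset of the upper
  vertices to be fully occupied. The union bound over these subsets with
  \<open>prob_subset_dla_le\<close> is a power with base at most 3/5 and exponent \<open>s\<close>,
  where \<open>s\<close> is at least \<open>n div 5\<close>.\<close>

lemma prob_dense_above_le:
  assumes v: "v \<subseteq> {0..<n}" "card v = k" and i: "1 \<le> i" "5 * (k + i) \<le> n" and t: "20 * t \<le> n choose (k + 1)"
  shows "measure_pmf.prob (dla n t)
     {C. real (card {y \<in> C. v \<subseteq> y \<and> card y = k + i}) > real ((n - k) choose i) / 2 ^ (i + 1)} \<le> (3 / 5) ^ (n div 5)"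
proof -
  define M where "M = (n - k) choose i"
  \<comment> \<open>The least integer strictly above the threshold.\<close>
  define s where "s = M div 2 ^ (i + 1) + 1"
  let ?Up = "{y. y \<subseteq> {0..<n} \<and> v \<subseteq> y \<and> card y = k + i}"
  have fU: "finite ?Up" by (rule finite_subset[of _ "Pow {0..<n}"]) auto
  have cU: "card ?Up = M" using card_up_set[OF v] by (simp add: M_def)
  have s: "real M / 2 ^ (i + 1) < real s"
  proof -
    have "M < 2 ^ (i + 1) * s" unfolding s_def using dividend_less_div_times[of "2 ^ (i + 1)" M]
      by (simp add: algebra_simps)
    then have "real M < real (2 ^ (i + 1) * s)" by (simp only: of_nat_less_iff)
    then have "real M < 2 ^ (i + 1) * real s" by (simp only: of_nat_mult of_nat_power of_nat_numeral)
    then show ?thesis by (simp add: divide_less_eq mult.commute)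
  qed
  \<comment> \<open>The growth of \<open>M\<close> outweighs the denominator of the threshold, so
    \<open>s\<close> exceeds \<open>(n - k) / 4\<close> for every \<open>i\<close>; as
    \<open>5 * k \<le> n\<close>, this makes \<open>s\<close> linear in \<open>n\<close>.\<close>
  have "2 ^ i * (n - k) \<le> 2 * M" unfolding M_def using i by (intro mult_2_power_le_choose) auto
  then have "real (2 ^ i * (n - k)) \<le> real (2 * M)" by (rule of_nat_mono)
  then have "2 ^ i * real (n - k) \<le> 2 * real M" by (simp only: of_nat_mult of_nat_power of_nat_numeral)
  then have "real (n - k) / 4 \<le> real M / 2 ^ (i + 1)" by (simp add: field_simps)
  then have "real (n - k) < 4 * real s" using s by linarith
  then have "n - k < 4 * s" by linarith
  then have "n < 4 * s + k" by simp
  then have "n < s * 5" using i by simp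
  then have sn: "n div 5 \<le> s" by (intro less_imp_le less_mult_imp_div_less)
  have kk: "4 ^ (i - 1) * (n choose (k + 1)) \<le> n choose (k + i)"
    using choose_mult_4_power_le[of "k + 1" "k + i" n] i by simp
  have p: "real t / real (n choose (k + i)) \<le> 1 / (20 * 4 ^ (i - 1))"
  proof -
    have "(20 * 4 ^ (i - 1)) * t \<le> 4 ^ (i - 1) * (n choose (k + 1))" using t by simp
    also note kk
    finally have "real ((20 * 4 ^ (i - 1)) * t) \<le> real (n choose (k + i))" by (rule of_nat_mono)
    then have "(20 * 4 ^ (i - 1)) * real t \<le> real (n choose (k + i))" by (simp only: of_nat_mult of_nat_power of_nat_numeral)
    moreover have "n choose (k + i) > 0" using i by simp
    ultimately show ?thesis by (simp add: field_simps)
  qed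
  let ?F = "{S. S \<subseteq> ?Up \<and> card S = s}"
  have fF: "finite ?F" using fU by simp
  have "measure_pmf.prob (dla n t)
     {C. real (card {y \<in> C. v \<subseteq> y \<and> card y = k + i}) > real ((n - k) choose i) / 2 ^ (i + 1)} \<le>
     measure_pmf.prob (dla n t) (\<Union>S\<in>?F. {C. S \<subseteq> C})"
  proof (intro measure_pmf.finite_measure_mono_AE)
    show "AE C in dla n t. C \<in> {C. real (card {y \<in> C. v \<subseteq> y \<and> card y = k + i}) > real ((n - k) choose i) / 2 ^ (i + 1)}
       \<longrightarrow> C \<in> (\<Union>S\<in>?F. {C. S \<subseteq> C})"
      unfolding AE_measure_pmf_iff
    proof safe
      fix C assume C: "C \<in> set_pmf (dla n t)"
        and g: "real ((n - k) choose i) / 2 ^ (i + 1) < real (card {y \<in> C. v \<subseteq> y \<and> card y = k + i})"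
      let ?Y = "{y \<in> C. v \<subseteq> y \<and> card y = k + i}"
      have "C \<subseteq> Pow {0..<n}" using cluster_dla[OF C] by (simp add: cluster_def)
      then have YU: "?Y \<subseteq> ?Up" by auto
      have "real M < 2 ^ (i + 1) * real (card ?Y)" using g by (simp add: M_def field_simps)
      then have "real M < real (2 ^ (i + 1) * card ?Y)" by (simp only: of_nat_mult of_nat_power of_nat_numeral)
      then have "M < 2 ^ (i + 1) * card ?Y" by (simp only: of_nat_less_iff)
      then have "s \<le> card ?Y" unfolding s_def
        by (simp add: Suc_le_eq less_mult_imp_div_less mult.commute)
      then obtain S where S: "S \<subseteq> ?Y" "card S = s" by (meson obtain_subset_with_card_n)
      have "S \<in> ?F" using S(2) order.trans[OF S(1) YU] by simp
      moreover have "C \<in> {C. S \<subseteq> C}" using S(1) by auto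
      ultimately show "C \<in> (\<Union>S\<in>?F. {C. S \<subseteq> C})" by (rule UN_I)
    qed
  qed auto
  also have "\<dots> \<le> (\<Sum>S\<in>?F. measure_pmf.prob (dla n t) {C. S \<subseteq> C})"
    using fF by (intro measure_pmf.finite_measure_subadditive_finite) auto
  also have "\<dots> \<le> (\<Sum>S\<in>?F. (real t / real (n choose (k + i))) ^ s)"
  proof (intro sum_mono)
    fix S assume S: "S \<in> ?F"
    then have "finite S" using finite_subset[OF _ fU] by simp
    then show "measure_pmf.prob (dla n t) {C. S \<subseteq> C} \<le> (real t / real (n choose (k + i))) ^ s"
      using prob_subset_dla_le[of S n "k + i" t] S i by auto
  qed
  also have "\<dots> = real (M choose s) * (real t / real (n choose (k + i))) ^ s"
    using n_subsets[OF fU, of s] cU by simp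
  also have "\<dots> \<le> (3 * real M / real s) ^ s * (1 / (20 * 4 ^ (i - 1))) ^ s"
    using p by (intro mult_mono choose_le_three_power power_mono) (auto simp: s_def)
  also have "\<dots> = (3 * real M / real s * (1 / (20 * 4 ^ (i - 1)))) ^ s" by (simp only: power_mult_distrib)
  also have "\<dots> \<le> (3 / 5) ^ s"
  proof (rule power_mono)
    have s0: "real s > 0" by (simp add: s_def)
    have "real M \<le> 2 ^ (i + 1) * real s" using s by (simp add: field_simps)
    then have "3 * real M / real s \<le> 3 * 2 ^ (i + 1)" using s0 by (simp add: field_simps)
    then have "3 * real M / real s * (1 / (20 * 4 ^ (i - 1))) \<le> 3 * 2 ^ (i + 1) * (1 / (20 * 4 ^ (i - 1)))"
      by (intro mult_right_mono) auto
    \<comment> \<open>At \<open>i = 1\<close> the base is exactly 12/20, which explains the 20 in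
      the hypothesis on \<open>t\<close>. For larger \<open>i\<close> it is smaller, since
      occupation probabilities fall by 4 per level and thresholds only by 2.\<close>
    also obtain i' where i': "i = Suc i'" using i by (cases i) auto
    have "3 * 2 ^ (i + 1) * (1 / (20 * 4 ^ (i - 1))) = (3 / 5) * (2 ^ i' / 4 ^ i' :: real)"
      unfolding i' by (simp add: field_simps)
    also have "\<dots> \<le> (3 / 5) * 1" by (intro mult_left_mono) (auto intro: power_mono)
    finally show "3 * real M / real s * (1 / (20 * 4 ^ (i - 1))) \<le> 3 / 5" by simp
  qed auto
  also have "\<dots> \<le> (3 / 5) ^ (n div 5)" by (rule power_decreasing[OF sn]) auto
  finally show ?thesis .
qed

text \<open>The union bound over level \<open>K\<close> turns \<open>prob_mem_dla_le\<close> into a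
  product of the ratios \<open>t / (n choose i)\<close> over \<open>i < K\<close>. Ratios up to
  \<open>M\<close> are bounded crudely by \<open>2 ^ n\<close>, those between \<open>M\<close> and
  \<open>h\<close> by 1, and the rest by \<open>1 / 4 ^ (h - M)\<close>; \<open>big\<close> lets the
  last group win with \<open>2 ^ n\<close> to spare.\<close>

lemma prob_level_occupied_le:
  assumes K: "5 * K \<le> n" "M < h" "h \<le> K" and T: "t \<le> n choose M"
    and big: "n * (M + 2) \<le> 2 * ((h - M) * (K - h))"
  shows "measure_pmf.prob (dla n t) {C. \<exists>x\<in>C. K \<le> card x} \<le> 1 / 2 ^ n"
proof -
  let ?L = "{x. x \<subseteq> {0..<n} \<and> card x = K}"
  have fL: "finite ?L" by (rule finite_subset[of _ "Pow {0..<n}"]) auto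
  have cL: "card ?L = n choose K" using n_subsets[of "{0..<n}" K] by simp
  let ?a = "\<lambda>i. real t / real (n choose i)"
  have pos: "real (n choose i) > 0" if "i \<le> K" for i using that K by simp
  have "measure_pmf.prob (dla n t) {C. \<exists>x\<in>C. K \<le> card x} \<le> measure_pmf.prob (dla n t) (\<Union>x\<in>?L. {C. x \<in> C})"
  proof (intro measure_pmf.finite_measure_mono_AE)
    show "AE C in dla n t. C \<in> {C. \<exists>x\<in>C. K \<le> card x} \<longrightarrow> C \<in> (\<Union>x\<in>?L. {C. x \<in> C})"
      unfolding AE_measure_pmf_iff
    proof safe
      fix C x assume C: "C \<in> set_pmf (dla n t)" and x: "x \<in> C" "K \<le> card x"
      from cluster_levels[OF cluster_dla[OF C] x] obtain y where "y \<in> C" "card y = K" by auto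
      then show "C \<in> (\<Union>x\<in>?L. {C. x \<in> C})" using cluster_dla[OF C] by (auto simp: cluster_def)
    qed
  qed auto
  also have "\<dots> \<le> (\<Sum>x\<in>?L. measure_pmf.prob (dla n t) {C. x \<in> C})"
    using fL by (intro measure_pmf.finite_measure_subadditive_finite) auto
  also have "\<dots> \<le> (\<Sum>x\<in>?L. real t ^ K / (\<Prod>i=1..K. real (n choose i)))"
    by (intro sum_mono prob_mem_dla_le) auto
  also have "\<dots> = real (n choose K) * (real t ^ K / (\<Prod>i=1..K. real (n choose i)))" by (simp add: cL)
  also have "\<dots> = (\<Prod>i\<in>{0..<K}. ?a i)"
  proof -
    \<comment> \<open>The size of level \<open>K\<close> cancels the last factor of the denominator.
      Inserting the factor at 0, which is 1, leaves exactly \<open>K\<close> factors for the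
      \<open>K\<close> powers of \<open>t\<close>.\<close>
    have "(\<Prod>i=1..K. real (n choose i)) = (\<Prod>i\<in>{0..K}. real (n choose i))"
      by (rule prod.mono_neutral_left) (auto simp: not_le)
    also have "\<dots> = (\<Prod>i\<in>{0..<K}. real (n choose i)) * real (n choose K)"
      by (metis atLeast0AtMost atLeast0LessThan lessThan_Suc_atMost prod.lessThan_Suc)
    finally have "real (n choose K) * (real t ^ K / (\<Prod>i=1..K. real (n choose i))) = real t ^ K / (\<Prod>i\<in>{0..<K}. real (n choose i))"
      using pos[of K] by simp
    also have "\<dots> = (\<Prod>i\<in>{0..<K}. ?a i)" by (simp add: prod_dividef)
    finally show ?thesis .
  qed
  also have "\<dots> = (\<Prod>i\<in>{0..<Suc M}. ?a i) * (\<Prod>i\<in>{Suc M..<h}. ?a i) * (\<Prod>i\<in>{h..<K}. ?a i)"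
    using K prod.atLeastLessThan_concat[of 0 "Suc M" h ?a] prod.atLeastLessThan_concat[of 0 h K ?a]
    by (simp only: Suc_le_eq le0 less_imp_le simp_thms)
  also have "\<dots> \<le> (\<Prod>i\<in>{0..<Suc M}. 2 ^ n) * (\<Prod>i\<in>{Suc M..<h}. 1) * (\<Prod>i\<in>{h..<K}. 1 / 4 ^ (h - M))"
  proof (intro mult_mono prod_mono conjI prod_nonneg)
    fix i assume i: "i \<in> {0..<Suc M}"
    have "t \<le> 2 ^ n" using T binomial_le_pow2[of n M] by (rule order.trans)
    then have "real t \<le> real (2 ^ n)" by (rule of_nat_mono)
    then have "real t \<le> 2 ^ n" by (simp only: of_nat_power of_nat_numeral)
    moreover have "real (n choose i) \<ge> 1" using i K by (simp add: Suc_le_eq)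
    then have "?a i \<le> real t / 1" by (intro divide_left_mono) (use i K in auto)
    ultimately show "?a i \<le> 2 ^ n" by linarith
  next
    fix i assume i: "i \<in> {Suc M..<h}"
    have "1 * (n choose M) \<le> 4 ^ (i - M) * (n choose M)" by (rule mult_le_mono1) simp
    also have "\<dots> \<le> n choose i" using i K by (intro choose_mult_4_power_le) auto
    finally have "t \<le> n choose i" using T by simp
    then show "?a i \<le> 1" using pos[of i] i K by simp
  next
    fix i assume i: "i \<in> {h..<K}"
    have "4 ^ (h - M) * t \<le> 4 ^ (i - M) * (n choose M)" using T i by (intro mult_le_mono power_increasing) auto
    also have "\<dots> \<le> n choose i" using i K by (intro choose_mult_4_power_le) auto
    finally have "real (4 ^ (h - M) * t) \<le> real (n choose i)" by (rule of_nat_mono)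
    then have "4 ^ (h - M) * real t \<le> real (n choose i)" by (simp only: of_nat_mult of_nat_power of_nat_numeral)
    then show "?a i \<le> 1 / 4 ^ (h - M)" using pos[of i] i K by (simp add: field_simps)
  qed auto
  also have "\<dots> = 2 ^ (n * Suc M) / 2 ^ (2 * ((h - M) * (K - h)))"
  proof -
    have "(\<Prod>i\<in>{0..<Suc M}. 2 ^ n :: real) = 2 ^ (n * Suc M)"
      by (simp only: prod_constant card_atLeastLessThan diff_zero power_mult)
    moreover have "(\<Prod>i\<in>{h..<K}. 1 / 4 ^ (h - M) :: real) = 1 / (2\<^sup>2) ^ ((h - M) * (K - h))"
      by (simp add: power_one_over power_mult)
    ultimately show ?thesis by (simp only: power_mult prod.neutral_const) simp
  qed
  also have "\<dots> \<le> 2 ^ (n * Suc M) / 2 ^ (n * (M + 2))"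
    by (intro divide_left_mono power_increasing big) auto
  also have "\<dots> = 1 / 2 ^ n" by (simp add: power_add field_simps)
  finally show ?thesis .
qed

lemma finite_level: "finite {x. x \<subseteq> {0..<n::nat} \<and> P x}"
  by (rule finite_subset[of _ "Pow {0..<n}"]) auto

lemma card_level: "card {x. x \<subseteq> {0..<n::nat} \<and> card x = k} = n choose k"
  using n_subsets[of "{0..<n}" k] by simp

text \<open>A violation at distance \<open>i\<close> needs an occupied vertex on level
  \<open>k + i\<close>. Either this level is at least \<open>n div 5\<close>, which
  \<open>prob_level_occupied_le\<close> makes unlikely, or \<open>prob_dense_above_le\<close>
  applies; the latter is summed over \<open>v\<close> and \<open>i\<close>.\<close>

lemma prob_not_sparse_le:
  assumes n: "10000 \<le> n" "1000 * (k + 1) \<le> n" and t: "20 * t \<le> n choose (k + 1)"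
  shows "measure_pmf.prob (dla n t) {C. \<exists>v. v \<subseteq> {0..<n} \<and> card v = k \<and> \<not> sparse_above n C v} \<le>
    1 / 2 ^ n + real (n choose k) * real n * (3 / 5) ^ (n div 5)"
proof -
  define K where "K = n div 5"
  \<comment> \<open>Halving makes both \<open>h - (k + 1)\<close> and \<open>K - h\<close> at least
    \<open>n / 20\<close>, so their product is quadratic in \<open>n\<close> and dominates
    \<open>n * (k + 3)\<close>.\<close>
  define h where "h = K div 2"
  let ?L = "{v. v \<subseteq> {0..<n} \<and> card v = k}"
  let ?I = "{i \<in> {1..n}. 5 * (k + i) \<le> n}"
  let ?D = "\<lambda>v i. {C. real (card {y \<in> C. v \<subseteq> y \<and> card y = k + i}) > real ((n - k) choose i) / 2 ^ (i + 1)}"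
  let ?O = "{C. \<exists>x\<in>C. K \<le> card x}"
  have occ: "measure_pmf.prob (dla n t) ?O \<le> 1 / 2 ^ n"
  proof (rule prob_level_occupied_le[where M = "k + 1" and h = h])
    show "5 * K \<le> n" "h \<le> K" by (auto simp: K_def h_def)
    have n': "1000 * k + 1000 \<le> n" using n by simp
    have K5: "n \<le> 5 * K + 4" unfolding K_def by linarith
    have h2: "K \<le> 2 * h + 1" "2 * h \<le> K" unfolding h_def by linarith+
    show "k + 1 < h" using K5 h2 n' n(1) by linarith
    show "t \<le> n choose (k + 1)" using t by simp
    have 1: "n \<le> 20 * (h - (k + 1))" using K5 h2 n' n(1) by linarith
    have 2: "n \<le> 20 * (K - h)" using K5 h2 n' n(1) by linarith
    have "200 * (k + 3) \<le> n" using n' by simp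
    then have "200 * (n * (k + 3)) \<le> n * n" by simp
    also have "\<dots> \<le> (20 * (h - (k + 1))) * (20 * (K - h))" by (rule mult_le_mono[OF 1 2])
    finally have *: "n * (k + 3) \<le> 2 * ((h - (k + 1)) * (K - h))" by (simp add: mult.commute)
    have e: "k + 1 + 2 = k + 3" by simp
    show "n * (k + 1 + 2) \<le> 2 * ((h - (k + 1)) * (K - h))" unfolding e by (rule *)
  qed
  have "measure_pmf.prob (dla n t) {C. \<exists>v. v \<subseteq> {0..<n} \<and> card v = k \<and> \<not> sparse_above n C v} \<le>
     measure_pmf.prob (dla n t) (?O \<union> (\<Union>v\<in>?L. \<Union>i\<in>?I. ?D v i))"
  proof (intro measure_pmf.finite_measure_mono subsetI)
    fix C assume "C \<in> {C. \<exists>v. v \<subseteq> {0..<n} \<and> card v = k \<and> \<not> sparse_above n C v}"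
    then obtain v where v: "v \<in> ?L" "\<not> sparse_above n C v" by auto
    then obtain i where i: "i \<ge> 1" "C \<in> ?D v i" by (auto simp: sparse_above_def not_le)
    show "C \<in> ?O \<union> (\<Union>v\<in>?L. \<Union>i\<in>?I. ?D v i)"
    proof (cases "C \<in> ?O")
      case False
      have "0 \<le> real ((n - k) choose i) / 2 ^ (i + 1)" by simp
      then have "card {y \<in> C. v \<subseteq> y \<and> card y = k + i} > 0" using i(2)
        by (simp only: mem_Collect_eq)
      then obtain y where "y \<in> C" "card y = k + i" by (auto simp: card_gt_0_iff)
      then have "k + i < K" using False by (auto simp: not_le)
      then have "i \<in> ?I" using i(1) by (auto simp: K_def)
      then show ?thesis using v(1) i(2) by blast
    qed simp
  qed simp
  also have "\<dots> \<le> measure_pmf.prob (dla n t) ?O + measure_pmf.prob (dla n t) (\<Union>v\<in>?L. \<Union>i\<in>?I. ?D v i)"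
    by (rule measure_Un_le) auto
  also have "measure_pmf.prob (dla n t) (\<Union>v\<in>?L. \<Union>i\<in>?I. ?D v i) \<le>
     (\<Sum>v\<in>?L. measure_pmf.prob (dla n t) (\<Union>i\<in>?I. ?D v i))"
    by (rule measure_pmf.finite_measure_subadditive_finite) (auto simp: finite_level)
  also have "\<dots> \<le> (\<Sum>v\<in>?L. \<Sum>i\<in>?I. measure_pmf.prob (dla n t) (?D v i))"
    by (intro sum_mono measure_pmf.finite_measure_subadditive_finite) auto
  also have "\<dots> \<le> (\<Sum>v\<in>?L. \<Sum>i\<in>?I. (3 / 5) ^ (n div 5))"
    using t by (intro sum_mono prob_dense_above_le) auto
  also have "\<dots> = real (n choose k) * (real (card ?I) * (3 / 5) ^ (n div 5))"
    by (simp only: sum_constant card_level)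
  also have "\<dots> \<le> real (n choose k) * (real n * (3 / 5) ^ (n div 5))"
  proof -
    have "card ?I \<le> card {1..n}" by (rule card_mono) auto
    then show ?thesis by (intro mult_left_mono mult_right_mono) auto
  qed
  finally show ?thesis using occ by (simp add: mult.assoc)
qed

subsection \<open>Induction over the levels\<close>

text \<open>Fullness of level \<open>k\<close> is measured locally, from each vertex of level
  \<open>k + 1\<close>. A global density would not bound the rate at which an individual vertex of
  the next level is hit.\<close>

definition saturated :: "real \<Rightarrow> nat \<Rightarrow> nat \<Rightarrow> nat set set \<Rightarrow> bool" where
  "saturated \<gamma> n k C \<longleftrightarrow>
     (\<forall>w. w \<subseteq> {0..<n} \<and> card w = Suc k \<longrightarrow> real (card {a \<in> w. w - {a} \<notin> C}) \<le> \<gamma> * real (Suc k))"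

lemma saturated_mono:
  assumes "saturated \<gamma> n k C" "C \<subseteq> C'"
  shows "saturated \<gamma> n k C'"
  unfolding saturated_def
proof (intro allI impI)
  fix w assume w: "w \<subseteq> {0..<n} \<and> card w = Suc k"
  then have "finite w" using finite_subset[of w "{0..<n}"] by simp
  then have "card {a \<in> w. w - {a} \<notin> C'} \<le> card {a \<in> w. w - {a} \<notin> C}"
    using assms(2) by (intro card_mono) auto
  moreover have "real (card {a \<in> w. w - {a} \<notin> C}) \<le> \<gamma> * real (Suc k)"
    using assms(1) w unfolding saturated_def by simp
  ultimately show "real (card {a \<in> w. w - {a} \<notin> C'}) \<le> \<gamma> * real (Suc k)" by linarith
qed

text \<open>The only lower neighbour of a singleton is the empty set.\<close>

lemma saturated_0:
  assumes "{} \<in> C" "\<gamma> \<ge> 0"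
  shows "saturated \<gamma> n 0 C"
  unfolding saturated_def
proof (intro allI impI)
  fix w assume "w \<subseteq> {0..<n} \<and> card w = Suc 0"
  then obtain b where "w = {b}" by (metis One_nat_def card_1_singletonE)
  then have "{a \<in> w. w - {a} \<notin> C} = {}" using assms by auto
  then have "card {a \<in> w. w - {a} \<notin> C} = 0" by (simp only: card.empty)
  then show "real (card {a \<in> w. w - {a} \<notin> C}) \<le> \<gamma> * real (Suc 0)" using assms(2) by simp
qed

text \<open>Double counting of the edges from unoccupied vertices of level \<open>k\<close> up to
  level \<open>k + 1\<close>: each such vertex has \<open>n - k\<close> upper neighbours, and
  saturation bounds the edges at every upper end.\<close>

lemma saturated_level_card:
  assumes sat: "saturated \<gamma> n k C" and "k < n" and C: "C \<subseteq> Pow {0..<n}"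
  shows "real (card {x \<in> C. card x = k}) \<ge> (1 - \<gamma>) * real (n choose k)"
proof -
  let ?U = "{x. x \<subseteq> {0..<n} \<and> (card x = k \<and> x \<notin> C)}"
  let ?W = "{w. w \<subseteq> {0..<n} \<and> card w = Suc k}"
  let ?L = "{x. x \<subseteq> {0..<n} \<and> card x = k}"
  have fin: "finite w" if "w \<subseteq> {0..<n}" for w using that finite_subset by auto
  have "bij_betw (\<lambda>(x, a). (insert a x, a)) (SIGMA x:?U. {0..<n} - x) (SIGMA w:?W. {a \<in> w. w - {a} \<notin> C})"
  proof (rule bij_betw_byWitness[where f' = "\<lambda>(w, a). (w - {a}, a)"], goal_cases)
    case 3
    show ?case using fin by auto
  next
    case 4
    show ?case using fin by auto
  qed auto
  then have "card (SIGMA x:?U. {0..<n} - x) = card (SIGMA w:?W. {a \<in> w. w - {a} \<notin> C})"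
    by (rule bij_betw_same_card)
  also have "card (SIGMA x:?U. {0..<n} - x) = (\<Sum>x\<in>?U. card ({0..<n} - x))"
    using finite_level by (intro card_SigmaI) auto
  also have "\<dots> = (\<Sum>x\<in>?U. n - k)"
    using fin by (intro sum.cong refl) (auto simp: card_Diff_subset)
  also have "\<dots> = card ?U * (n - k)" by simp
  also have "card (SIGMA w:?W. {a \<in> w. w - {a} \<notin> C}) = (\<Sum>w\<in>?W. card {a \<in> w. w - {a} \<notin> C})"
    using finite_level fin by (intro card_SigmaI) auto
  finally have "real (card ?U) * real (n - k) = (\<Sum>w\<in>?W. real (card {a \<in> w. w - {a} \<notin> C}))"
    by (simp only: of_nat_mult[symmetric] of_nat_sum[symmetric])
  also have "\<dots> \<le> (\<Sum>w\<in>?W. \<gamma> * real (Suc k))"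
    using sat unfolding saturated_def by (intro sum_mono) auto
  also have "\<dots> = \<gamma> * real (Suc k * (n choose Suc k))"
    by (simp only: sum_constant card_level of_nat_mult mult_ac)
  also have "Suc k * (n choose Suc k) = (n - k) * (n choose k)"
    by (metis binomial_absorb_comp binomial_absorption)
  finally have "real (card ?U) * real (n - k) \<le> (\<gamma> * real (n choose k)) * real (n - k)" by (simp add: mult_ac)
  then have U: "real (card ?U) \<le> \<gamma> * real (n choose k)" using assms(2) by simp
  have "?L = {x \<in> C. card x = k} \<union> ?U" using C by auto
  then have "card ?L = card ({x \<in> C. card x = k} \<union> ?U)" by (rule arg_cong)
  also have "\<dots> \<le> card {x \<in> C. card x = k} + card ?U" by (rule card_Un_le)
  finally have "real (n choose k) \<le> real (card {x \<in> C. card x = k}) + real (card ?U)"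
    unfolding card_level by linarith
  then show ?thesis using U by (simp add: algebra_simps)
qed

text \<open>Failure at some \<open>w\<close> leaves a large set \<open>S\<close> of lower neighbours
  of \<open>w\<close> unoccupied. Fixing \<open>w\<close> and \<open>S\<close> beforehand costs a
  union bound over at most \<open>(n choose (k + 2)) * 2 ^ (k + 2)\<close> pairs, and each
  \<open>S\<close> survives with exponentially small probability by
  \<open>prob_dla_from_avoid_le\<close>.\<close>

lemma prob_not_saturated_from_le:
  assumes C: "cluster n C" and sat: "saturated \<gamma> n k C" and g: "0 \<le> \<gamma>" "\<gamma> \<le> 1 / 2" and k: "Suc k < n"
  shows "measure_pmf.prob (dla_from n t C)
     {C'. \<not> saturated \<gamma> n (Suc k) C' \<and> (\<forall>v. v \<subseteq> {0..<n} \<and> card v = Suc k \<longrightarrow> sparse_above n C' v)} \<le>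
     real (n choose (k + 2)) * 2 ^ (k + 2) * exp (- (\<gamma> * real (k + 2) * real t / (4 * real (n choose Suc k))))"
    (is "_ \<le> _ * ?e")
proof -
  let ?W = "{w. w \<subseteq> {0..<n} \<and> card w = k + 2}"
  let ?down = "\<lambda>w. (\<lambda>a. w - {a}) ` w"
  let ?I = "SIGMA w:?W. {S. S \<subseteq> ?down w \<and> \<gamma> * real (k + 2) \<le> real (card S)}"
  let ?E = "\<lambda>S. {C'. S \<inter> C' = {} \<and> (\<forall>v\<in>S. sparse_above n C' v)}"
  have fw: "finite w" if "w \<subseteq> {0..<n}" for w using that finite_subset by auto
  have sub1: "?I \<subseteq> (SIGMA w:?W. Pow (?down w))" by auto
  have fin1: "finite (SIGMA w:?W. Pow (?down w))"
    using fw by (intro finite_SigmaI finite_level) auto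
  have fI: "finite ?I" by (rule finite_subset[OF sub1 fin1])
  have "card ?I \<le> card (SIGMA w:?W. Pow (?down w))" by (rule card_mono[OF fin1 sub1])
  also have "\<dots> = (\<Sum>w\<in>?W. card (Pow (?down w)))"
    using fw by (intro card_SigmaI finite_level) auto
  also have "\<dots> \<le> (\<Sum>w\<in>?W. 2 ^ (k + 2))"
  proof (intro sum_mono)
    fix w assume w: "w \<in> ?W"
    have "card (?down w) \<le> k + 2" using card_image_le[of w "\<lambda>a. w - {a}"] w fw by auto
    then have "(2::nat) ^ card (?down w) \<le> 2 ^ (k + 2)" by (rule power_increasing) simp
    moreover have "finite (?down w)" using fw w by simp
    ultimately show "card (Pow (?down w)) \<le> 2 ^ (k + 2)" by (simp only: card_Pow)
  qed
  also have "\<dots> = (n choose (k + 2)) * 2 ^ (k + 2)" by (simp only: sum_constant card_level of_nat_id)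
  finally have "real (card ?I) \<le> real ((n choose (k + 2)) * 2 ^ (k + 2))" by (rule of_nat_mono)
  then have cI: "real (card ?I) \<le> real (n choose (k + 2)) * 2 ^ (k + 2)"
    by (simp only: of_nat_mult of_nat_power of_nat_numeral)
  have "measure_pmf.prob (dla_from n t C)
     {C'. \<not> saturated \<gamma> n (Suc k) C' \<and> (\<forall>v. v \<subseteq> {0..<n} \<and> card v = Suc k \<longrightarrow> sparse_above n C' v)} \<le>
     measure_pmf.prob (dla_from n t C) (\<Union>p\<in>?I. ?E (snd p))"
  proof (intro measure_pmf.finite_measure_mono subsetI)
    fix C' assume "C' \<in> {C'. \<not> saturated \<gamma> n (Suc k) C' \<and> (\<forall>v. v \<subseteq> {0..<n} \<and> card v = Suc k \<longrightarrow> sparse_above n C' v)}"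
    then obtain w where w: "w \<subseteq> {0..<n}" "card w = k + 2"
        "\<gamma> * real (k + 2) < real (card {a \<in> w. w - {a} \<notin> C'})"
      and sp: "\<And>v. v \<subseteq> {0..<n} \<Longrightarrow> card v = Suc k \<Longrightarrow> sparse_above n C' v"
      by (auto simp: saturated_def not_le)
    let ?S = "(\<lambda>a. w - {a}) ` {a \<in> w. w - {a} \<notin> C'}"
    have "inj_on (\<lambda>a. w - {a}) {a \<in> w. w - {a} \<notin> C'}" by (rule inj_onI) blast
    then have "card ?S = card {a \<in> w. w - {a} \<notin> C'}" by (rule card_image)
    then have "(w, ?S) \<in> ?I" using w by auto
    moreover have "sparse_above n C' (w - {x})" if "x \<in> w" for x
      using sp[of "w - {x}"] w that by (auto simp: card_Diff_singleton)
    then have "C' \<in> ?E (snd (w, ?S))" by auto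
    ultimately show "C' \<in> (\<Union>p\<in>?I. ?E (snd p))" by (rule UN_I)
  qed simp
  also have "\<dots> \<le> (\<Sum>p\<in>?I. measure_pmf.prob (dla_from n t C) (?E (snd p)))"
    using fI by (intro measure_pmf.finite_measure_subadditive_finite) auto
  also have "\<dots> \<le> (\<Sum>p\<in>?I. ?e)"
  proof (intro sum_mono)
    fix p assume "p \<in> ?I"
    then obtain w S where p: "p = (w, S)" "w \<subseteq> {0..<n}" "card w = k + 2" "S \<subseteq> ?down w"
      "\<gamma> * real (k + 2) \<le> real (card S)" by auto
    have Sl: "v \<subseteq> {0..<n} \<and> card v = Suc k" if "v \<in> S" for v
      using p that fw[OF p(2)] by (auto simp: card_Diff_singleton)
    then have SL: "S \<subseteq> {v. v \<subseteq> {0..<n} \<and> card v = Suc k}" by blast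
    have fS: "finite S" using finite_subset[OF SL finite_level] .
    have "card S \<le> card {v. v \<subseteq> {0..<n} \<and> card v = Suc k}" by (rule card_mono[OF finite_level SL])
    then have cS: "card S \<le> n choose Suc k" by (simp only: card_level)
    have N0: "real (n choose Suc k) > 0" using k by simp
    define r where "r = real (card S) / (4 * real (n choose Suc k))"
    have r1: "r \<le> 1" using cS N0 by (simp add: r_def)
    have "measure_pmf.prob (dla_from n t C) (?E S) \<le> (1 - r) ^ t"
    proof (rule prob_dla_from_avoid_le[OF C _ k fS _ r_def r1])
      fix v assume "v \<in> S"
      then have v: "v \<subseteq> {0..<n}" "card v = Suc k" using Sl by auto
      \<comment> \<open>Only here does \<gamma> at most 1/2 matter: saturation one level below
        leaves at least half of the lower neighbours of \<open>v\<close> occupied.\<close>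
      have "real (card {a \<in> v. v - {a} \<notin> C}) \<le> \<gamma> * real (Suc k)"
        using sat v by (simp add: saturated_def)
      also have "\<dots> \<le> 1 / 2 * real (Suc k)" using g by (intro mult_right_mono) auto
      finally have "real (2 * card {a \<in> v. v - {a} \<notin> C}) \<le> real (Suc k)" by simp
      then have 1: "2 * card {a \<in> v. v - {a} \<notin> C} \<le> Suc k" by (simp only: of_nat_le_iff)
      have "card v = card ({a \<in> v. v - {a} \<in> C} \<union> {a \<in> v. v - {a} \<notin> C})"
        by (rule arg_cong[where f = card]) auto
      also have "\<dots> \<le> card {a \<in> v. v - {a} \<in> C} + card {a \<in> v. v - {a} \<notin> C}" by (rule card_Un_le)
      finally show "v \<subseteq> {0..<n} \<and> card v = Suc k \<and> Suc k \<le> 2 * card {a \<in> v. v - {a} \<in> C}"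
        using v 1 by linarith
    qed simp
    also have "\<dots> \<le> exp (- r) ^ t"
      using exp_ge_add_one_self[of "- r"] r1 by (intro power_mono) auto
    also have "\<dots> = exp (- (real (card S) * real t / (4 * real (n choose Suc k))))"
      by (simp add: exp_of_nat_mult[symmetric] r_def mult.commute)
    also have "\<dots> \<le> ?e"
      using p(5) by (simp add: divide_right_mono mult_right_mono)
    finally show "measure_pmf.prob (dla_from n t C) (?E (snd p)) \<le> ?e" using p(1) by simp
  qed
  also have "\<dots> = real (card ?I) * ?e" by simp
  also have "\<dots> \<le> real (n choose (k + 2)) * 2 ^ (k + 2) * ?e"
    using cI by (intro mult_right_mono) auto
  finally show ?thesis .
qed

text \<open>Condition on the cluster at time \<open>s\<close>. Sparseness is required only at the
  final time \<open>s + t\<close>, because it passes to smaller clusters. The same \<gamma> appears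
  on both levels, so iteration adds up failure probabilities but does not weaken the
  saturation.\<close>

lemma prob_not_saturated_step:
  assumes g: "0 \<le> \<gamma>" "\<gamma> \<le> 1 / 2" and k: "Suc k < n"
  shows "measure_pmf.prob (dla n (s + t)) {C. \<not> saturated \<gamma> n (Suc k) C} \<le>
     measure_pmf.prob (dla n s) {C. \<not> saturated \<gamma> n k C} +
     measure_pmf.prob (dla n (s + t)) {C. \<exists>v. v \<subseteq> {0..<n} \<and> card v = Suc k \<and> \<not> sparse_above n C v} +
     real (n choose (k + 2)) * 2 ^ (k + 2) * exp (- (\<gamma> * real (k + 2) * real t / (4 * real (n choose Suc k))))"
    (is "_ \<le> _ + _ + ?c")
proof -
  let ?Q = "{C. \<exists>v. v \<subseteq> {0..<n} \<and> card v = Suc k \<and> \<not> sparse_above n C v}"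
  let ?B = "{C. \<not> saturated \<gamma> n (Suc k) C \<and> (\<forall>v. v \<subseteq> {0..<n} \<and> card v = Suc k \<longrightarrow> sparse_above n C v)}"
  have c0: "0 \<le> ?c" by simp
  have "measure_pmf.prob (dla n (s + t)) {C. \<not> saturated \<gamma> n (Suc k) C} \<le> measure_pmf.prob (dla n (s + t)) (?Q \<union> ?B)"
    by (intro measure_pmf.finite_measure_mono) auto
  also have "\<dots> \<le> measure_pmf.prob (dla n (s + t)) ?Q + measure_pmf.prob (dla n (s + t)) ?B"
    by (rule measure_Un_le) auto
  also have "measure_pmf.prob (dla n (s + t)) ?B \<le>
     measure_pmf.prob (dla n s) {C. \<not> saturated \<gamma> n k C} + (\<Sum>i\<in>{()}. ?c * measure_pmf.prob (dla n s) UNIV)"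
    unfolding dla_add
  proof (rule prob_bind_pmf_le)
    fix C assume C: "C \<in> set_pmf (dla n s)"
    show "measure_pmf.prob (dla_from n t C) ?B \<le> indicator {C. \<not> saturated \<gamma> n k C} C + (\<Sum>i\<in>{()}. ?c * indicator UNIV C)"
    proof (cases "saturated \<gamma> n k C")
      case True
      have "measure_pmf.prob (dla_from n t C) ?B \<le> ?c"
        by (rule prob_not_saturated_from_le[OF cluster_dla[OF C] True g k])
      then show ?thesis using True by simp
    next
      case False
      have "measure_pmf.prob (dla_from n t C) ?B \<le> 1" by simp
      moreover have "indicator {C. \<not> saturated \<gamma> n k C} C = (1 :: real)" using False by simp
      moreover have "(\<Sum>i\<in>{()}. ?c * indicator UNIV C) = ?c" by simp
      ultimately show ?thesis using c0 by linarith
    qed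
  qed
  finally show ?thesis by simp
qed

lemma prob_not_saturated_antimono:
  assumes "s \<le> t"
  shows "measure_pmf.prob (dla n t) {C. \<not> saturated \<gamma> n k C} \<le> measure_pmf.prob (dla n s) {C. \<not> saturated \<gamma> n k C}"
proof -
  have "measure_pmf.prob (bind_pmf (dla n s) (dla_from n (t - s))) {C. \<not> saturated \<gamma> n k C} \<le>
     measure_pmf.prob (dla n s) {C. \<not> saturated \<gamma> n k C} + (\<Sum>i\<in>({} :: unit set). 0 * measure_pmf.prob (dla n s) {})"
  proof (rule prob_bind_pmf_le)
    fix C assume C: "C \<in> set_pmf (dla n s)"
    show "measure_pmf.prob (dla_from n (t - s) C) {C. \<not> saturated \<gamma> n k C} \<le>
      indicator {C. \<not> saturated \<gamma> n k C} C + (\<Sum>i\<in>({} :: unit set). 0 * indicator {} C)"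
    proof (cases "saturated \<gamma> n k C")
      case True
      then have "measure_pmf.prob (dla_from n (t - s) C) {C. \<not> saturated \<gamma> n k C} = 0"
        using cluster_dla_from(2)[OF cluster_dla[OF C]] saturated_mono
        by (subst measure_pmf_zero_iff) auto
      then show ?thesis by simp
    qed simp
  qed
  then show ?thesis using dla_add[of n s "t - s"] assms by simp
qed

section \<open>Time schedule and the error of one level\<close>

definition fill_time :: "nat \<Rightarrow> nat \<Rightarrow> nat" where
  "fill_time n k = (n choose (k + 1)) div 20"

text \<open>The next binomial coefficient is at least 4 times larger, so the difference keeps a
  fixed fraction of it. The rounding in \<open>div\<close> is absorbed because the smaller
  coefficient is at least \<open>n\<close>, hence at least 100.\<close>

lemma fill_time_gap:
  assumes "100 \<le> n" "5 * (k + 2) \<le> n"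
  shows "fill_time n k \<le> fill_time n (Suc k)"
    "n choose (k + 2) \<le> 40 * (fill_time n (Suc k) - fill_time n k)"
proof -
  define a where "a = n choose (k + 1)"
  define b where "b = n choose (k + 2)"
  have "4 * (n choose (k + 1)) \<le> n choose (Suc (k + 1))"
    using assms by (intro choose_Suc_ge) auto
  then have ab: "4 * a \<le> b" by (simp add: a_def b_def)
  have "2 * n \<le> 2 ^ (k + 1) * n" by (intro mult_le_mono1) simp
  also have "\<dots> \<le> 2 * a"
    unfolding a_def using assms by (intro mult_2_power_le_choose) auto
  finally have "n \<le> a" by simp
  then have a: "100 \<le> a" using assms by simp
  have t: "fill_time n k = a div 20" "fill_time n (Suc k) = b div 20"
    by (simp_all add: fill_time_def a_def b_def)
  show "fill_time n k \<le> fill_time n (Suc k)" unfolding t using ab by (intro div_le_mono) simp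
  have "20 * (a div 20) \<le> a" "b \<le> 20 * (b div 20) + 19" by linarith+
  then have "b \<le> 40 * (b div 20 - a div 20)" using ab a by linarith
  then show "n choose (k + 2) \<le> 40 * (fill_time n (Suc k) - fill_time n k)"
    unfolding t by (simp only: b_def)
qed

text \<open>Uses \<open>1 - 2 / 5 \<le> exp (- 2 / 5)\<close>; the constant \<open>2 / 5\<close> in
  the exponent pays for rounding in \<open>n div 5\<close>.\<close>

lemma three_fifths_power_le: "(3 / 5) ^ (n div 5) \<le> exp (2 / 5 - 8 / 100 * real n)"
proof -
  have "(3 / 5 :: real) \<le> exp (- 2 / 5)" using exp_ge_add_one_self[of "- 2 / 5 :: real"] by simp
  then have "(3 / 5) ^ (n div 5) \<le> exp (- 2 / 5 :: real) ^ (n div 5)" by (intro power_mono) auto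
  also have "\<dots> = exp (real (n div 5) * (- 2 / 5))" by (rule exp_of_nat_mult[symmetric])
  also have "\<dots> \<le> exp (2 / 5 - 8 / 100 * real n)"
  proof -
    have "n \<le> 5 * (n div 5) + 4" by linarith
    then have "real n \<le> 5 * real (n div 5) + 4" by linarith
    then show ?thesis by simp
  qed
  finally show ?thesis .
qed

text \<open>A bound for one induction step that does not depend on the level. The terms account for
  occupied high levels, for violated thresholds on lower levels, and for vertices that wait too long
  to be hit.\<close>

definition fill_error :: "real \<Rightarrow> nat \<Rightarrow> real" where
  "fill_error \<epsilon> n = 1 / 2 ^ n + real n * exp (2 / 5 - 7 / 100 * real n) + exp (- (\<epsilon> / 500 * real n))"

lemma prob_not_saturated_fill_time_Suc:
  assumes e: "0 < \<epsilon>" "\<epsilon> \<le> 1/100" and n: "10000 \<le> n" and k: "real (k + 2) \<le> 2 * \<epsilon> ^ 3 * real n"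
  shows "measure_pmf.prob (dla n (fill_time n (Suc k))) {C. \<not> saturated (2 * \<epsilon>) n (Suc k) C} \<le>
    measure_pmf.prob (dla n (fill_time n k)) {C. \<not> saturated (2 * \<epsilon>) n k C} + fill_error \<epsilon> n"
proof -
  have "\<epsilon> ^ 3 \<le> (1 / 100) ^ 3" using e by (intro power_mono) auto
  then have "\<epsilon> ^ 3 * real n \<le> (1 / 100) ^ 3 * real n" by (rule mult_right_mono) simp
  then have "1000 * real (k + 2) \<le> real n" using k by (simp add: power3_eq_cube)
  then have "real (1000 * (k + 2)) \<le> real n" by simp
  then have kn: "1000 * (k + 2) \<le> n" by (simp only: of_nat_le_iff)
  have k5: "5 * (k + 2) \<le> n" using kn by simp
  let ?s = "fill_time n k"
  let ?t = "fill_time n (Suc k) - fill_time n k"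
  have st: "?s + ?t = fill_time n (Suc k)" using fill_time_gap(1)[of n k] n k5 by simp
  define a where "a = real (n choose Suc k)"
  define b where "b = real (n choose (k + 2))"
  have a0: "a > 0" using k5 by (simp add: a_def)
  have A: "measure_pmf.prob (dla n (?s + ?t)) {C. \<exists>v. v \<subseteq> {0..<n} \<and> card v = Suc k \<and> \<not> sparse_above n C v} \<le>
     1 / 2 ^ n + real n * exp (2 / 5 - 7 / 100 * real n)"
  proof -
    have "measure_pmf.prob (dla n (?s + ?t)) {C. \<exists>v. v \<subseteq> {0..<n} \<and> card v = Suc k \<and> \<not> sparse_above n C v} \<le>
      1 / 2 ^ n + real (n choose Suc k) * real n * (3 / 5) ^ (n div 5)"
      unfolding st
    proof (rule prob_not_sparse_le[OF n])
      show "1000 * (Suc k + 1) \<le> n" using kn by simp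
      show "20 * fill_time n (Suc k) \<le> n choose (Suc k + 1)" unfolding fill_time_def by simp
    qed
    also have "real (n choose Suc k) * real n * (3 / 5) ^ (n div 5) \<le>
       exp (1 / 100 * real n) * real n * exp (2 / 5 - 8 / 100 * real n)"
    proof (intro mult_mono three_fifths_power_le)
      have "1 * real (n choose Suc k) \<le> 2 ^ Suc k * real (n choose Suc k)"
        by (rule mult_right_mono) (auto intro: one_le_power simp del: power_Suc)
      also have "\<dots> \<le> exp (\<epsilon> * real n / 100)"
        using k by (intro choose_mult_2_power_le_exp[OF e]) simp
      also have "\<dots> \<le> exp (1 / 100 * real n)" using e by (simp add: mult_left_le_one_le)
      finally show "real (n choose Suc k) \<le> exp (1 / 100 * real n)" by simp
    qed auto
    also have "\<dots> = real n * exp (1 / 100 * real n + (2 / 5 - 8 / 100 * real n))"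
      by (simp only: exp_add mult_ac)
    also have "1 / 100 * real n + (2 / 5 - 8 / 100 * real n) = 2 / 5 - 7 / 100 * real n" by simp
    finally show ?thesis by simp
  qed
  \<comment> \<open>The gap is at least \<open>b / 40\<close> and
    \<open>(k + 2) * b = (n - k - 1) * a\<close>, so the exponent is at least
    \<open>\<epsilon> * (n - k - 1) / 80\<close>, hence at least \<open>\<epsilon> * n / 81\<close>.
    The union bound costs only \<open>\<epsilon> * n / 100\<close> in the exponent.\<close>
  have B: "b * 2 ^ (k + 2) * exp (- (2 * \<epsilon> * real (k + 2) * real ?t / (4 * a))) \<le> exp (- (\<epsilon> / 500 * real n))"
  proof -
    have "real (n choose (k + 2)) \<le> real (40 * ?t)"
      using fill_time_gap(2)[of n k] n k5 by (intro of_nat_mono) simp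
    then have bt: "b \<le> 40 * real ?t" by (simp only: b_def of_nat_mult of_nat_numeral)
    have "Suc (Suc k) * (n choose Suc (Suc k)) = (n - Suc k) * (n choose Suc k)"
      by (metis binomial_absorb_comp binomial_absorption)
    then have "real (Suc (Suc k) * (n choose Suc (Suc k))) = real ((n - Suc k) * (n choose Suc k))"
      by (rule arg_cong)
    then have ab: "real (k + 2) * b = real (n - Suc k) * a"
      unfolding a_def b_def of_nat_mult by simp
    have "\<epsilon> * real n / 81 \<le> 2 * \<epsilon> * real (n - Suc k) / 160"
    proof -
      have "160 * real n \<le> 162 * real (n - Suc k)" using kn by simp
      then have "\<epsilon> * (160 * real n) \<le> \<epsilon> * (162 * real (n - Suc k))" using e by (intro mult_left_mono) auto
      then show ?thesis by simp
    qed
    also have "\<dots> = 2 * \<epsilon> * (real (n - Suc k) * a) / (160 * a)" using a0 by simp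
    also have "\<dots> = 2 * \<epsilon> * real (k + 2) * b / (160 * a)" by (simp only: ab[symmetric] mult.assoc)
    also have "\<dots> \<le> 2 * \<epsilon> * real (k + 2) * (40 * real ?t) / (160 * a)"
      using e a0 bt by (intro divide_right_mono mult_left_mono) auto
    also have "\<dots> = 2 * \<epsilon> * real (k + 2) * real ?t / (4 * a)" by simp
    finally have 1: "\<epsilon> * real n / 81 \<le> 2 * \<epsilon> * real (k + 2) * real ?t / (4 * a)" .
    have "b * 2 ^ (k + 2) \<le> exp (\<epsilon> * real n / 100)"
      using choose_mult_2_power_le_exp[OF e k] by (simp only: b_def mult.commute)
    then have "b * 2 ^ (k + 2) * exp (- (2 * \<epsilon> * real (k + 2) * real ?t / (4 * a))) \<le>
      exp (\<epsilon> * real n / 100) * exp (- (\<epsilon> * real n / 81))"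
      using 1 by (intro mult_mono) auto
    also have "\<dots> = exp (\<epsilon> * real n / 100 - \<epsilon> * real n / 81)" by (simp only: exp_add[symmetric]) simp
    also have "\<dots> \<le> exp (- (\<epsilon> / 500 * real n))"
    proof -
      have "\<epsilon> * real n \<ge> 0" using e by simp
      then show ?thesis by simp
    qed
    finally show ?thesis .
  qed
  have "measure_pmf.prob (dla n (?s + ?t)) {C. \<not> saturated (2 * \<epsilon>) n (Suc k) C} \<le>
     measure_pmf.prob (dla n ?s) {C. \<not> saturated (2 * \<epsilon>) n k C} +
     measure_pmf.prob (dla n (?s + ?t)) {C. \<exists>v. v \<subseteq> {0..<n} \<and> card v = Suc k \<and> \<not> sparse_above n C v} +
     b * 2 ^ (k + 2) * exp (- (2 * \<epsilon> * real (k + 2) * real ?t / (4 * a)))"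
    unfolding a_def b_def using e k5 by (intro prob_not_saturated_step) auto
  then have "measure_pmf.prob (dla n (?s + ?t)) {C. \<not> saturated (2 * \<epsilon>) n (Suc k) C} \<le>
    measure_pmf.prob (dla n ?s) {C. \<not> saturated (2 * \<epsilon>) n k C} + fill_error \<epsilon> n"
    using A B unfolding fill_error_def by linarith
  then show ?thesis unfolding st .
qed

lemma fill_error_nonneg: "fill_error \<epsilon> n \<ge> 0"
  by (simp add: fill_error_def)

text \<open>Starts from level 0, which every cluster saturates, and adds one
  \<open>fill_error\<close> per level.\<close>

lemma prob_not_saturated_fill_time:
  assumes e: "0 < \<epsilon>" "\<epsilon> \<le> 1/100" and n: "10000 \<le> n" and k: "real (k + 1) \<le> 2 * \<epsilon> ^ 3 * real n"
  shows "measure_pmf.prob (dla n (fill_time n k)) {C. \<not> saturated (2 * \<epsilon>) n k C} \<le> real k * fill_error \<epsilon> n"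
  using k
proof (induction k)
  case 0
  have "saturated (2 * \<epsilon>) n 0 C" if "C \<in> set_pmf (dla n t)" for C t
    using cluster_dla[OF that] e by (intro saturated_0) (auto simp: cluster_def)
  then have "measure_pmf.prob (dla n (fill_time n 0)) {C. \<not> saturated (2 * \<epsilon>) n 0 C} = 0"
    by (subst measure_pmf_zero_iff) auto
  then show ?case by simp
next
  case (Suc k)
  have "measure_pmf.prob (dla n (fill_time n k)) {C. \<not> saturated (2 * \<epsilon>) n k C} \<le> real k * fill_error \<epsilon> n"
    using Suc by simp
  moreover have "real (Suc k) * fill_error \<epsilon> n = real k * fill_error \<epsilon> n + fill_error \<epsilon> n"
    by (simp add: algebra_simps)
  ultimately show ?case
    using prob_not_saturated_fill_time_Suc[OF e n, of k] Suc.prems by (simp add: add.commute)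
qed

lemma prob_level_sparse_final_le:
  assumes e: "0 < \<epsilon>" "\<epsilon> \<le> 1/100" and n: "10000 \<le> n" "1 \<le> \<epsilon> ^ 3 * real n"
  shows "measure_pmf.prob (dla_final n)
     {C. \<not> (\<forall>k::nat. real k < \<epsilon>^3 * real n \<longrightarrow>
                 real (card {x \<in> C. card x = k}) \<ge> (1 - 2*\<epsilon>) * real (n choose k))} \<le> (real n)\<^sup>2 * fill_error \<epsilon> n"
proof -
  let ?I = "{k. real k < \<epsilon>^3 * real n}"
  have "\<epsilon> ^ 3 \<le> 1" using e by (intro power_le_one) auto
  then have e3: "\<epsilon> ^ 3 * real n \<le> real n" by (intro mult_left_le_one_le) (use e in auto)
  have In: "?I \<subseteq> {..<n}"
  proof
    fix k assume "k \<in> ?I"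
    then have "real k < real n" using e3 by simp
    then show "k \<in> {..<n}" by simp
  qed
  have fI: "finite ?I" by (rule finite_subset[OF In]) simp
  have "measure_pmf.prob (dla_final n)
     {C. \<not> (\<forall>k::nat. real k < \<epsilon>^3 * real n \<longrightarrow>
                 real (card {x \<in> C. card x = k}) \<ge> (1 - 2*\<epsilon>) * real (n choose k))} \<le>
     measure_pmf.prob (dla_final n) (\<Union>k\<in>?I. {C. \<not> saturated (2 * \<epsilon>) n k C})"
  proof (intro measure_pmf.finite_measure_mono_AE)
    show "AE C in dla_final n. C \<in> {C. \<not> (\<forall>k::nat. real k < \<epsilon>^3 * real n \<longrightarrow>
                 real (card {x \<in> C. card x = k}) \<ge> (1 - 2*\<epsilon>) * real (n choose k))} \<longrightarrow>
       C \<in> (\<Union>k\<in>?I. {C. \<not> saturated (2 * \<epsilon>) n k C})"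
      unfolding AE_measure_pmf_iff
    proof (intro ballI impI)
      fix C assume C: "C \<in> set_pmf (dla_final n)" and "C \<in> {C. \<not> (\<forall>k::nat. real k < \<epsilon>^3 * real n \<longrightarrow>
                 real (card {x \<in> C. card x = k}) \<ge> (1 - 2*\<epsilon>) * real (n choose k))}"
      then obtain k where k: "k \<in> ?I" "\<not> real (card {x \<in> C. card x = k}) \<ge> (1 - 2*\<epsilon>) * real (n choose k)"
        by auto
      have "C \<subseteq> Pow {0..<n}" using cluster_dla[of C n "2 ^ n"] C by (simp add: dla_final_def cluster_def)
      moreover have "k < n" using In k(1) by blast
      ultimately have "\<not> saturated (2 * \<epsilon>) n k C"
        using k(2) saturated_level_card by blast
      then show "C \<in> (\<Union>k\<in>?I. {C. \<not> saturated (2 * \<epsilon>) n k C})" using k(1) by blast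
    qed
  qed auto
  also have "\<dots> \<le> (\<Sum>k\<in>?I. measure_pmf.prob (dla_final n) {C. \<not> saturated (2 * \<epsilon>) n k C})"
    using fI by (intro measure_pmf.finite_measure_subadditive_finite) auto
  also have "\<dots> \<le> (\<Sum>k\<in>?I. real n * fill_error \<epsilon> n)"
  proof (intro sum_mono)
    fix k assume k: "k \<in> ?I"
    have kn: "k < n" using In k by blast
    \<comment> \<open>The fill time precedes time \<open>2 ^ n\<close>, and saturation, once
      reached, persists up to the final cluster.\<close>
    have "fill_time n k \<le> n choose (k + 1)" by (simp add: fill_time_def)
    also have "\<dots> \<le> 2 ^ n" by (rule binomial_le_pow2)
    finally have "measure_pmf.prob (dla_final n) {C. \<not> saturated (2 * \<epsilon>) n k C} \<le>
      measure_pmf.prob (dla n (fill_time n k)) {C. \<not> saturated (2 * \<epsilon>) n k C}"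
      unfolding dla_final_def by (rule prob_not_saturated_antimono)
    also have "\<dots> \<le> real k * fill_error \<epsilon> n"
      using k n by (intro prob_not_saturated_fill_time[OF e]) auto
    also have "\<dots> \<le> real n * fill_error \<epsilon> n"
      using kn fill_error_nonneg by (intro mult_right_mono) auto
    finally show "measure_pmf.prob (dla_final n) {C. \<not> saturated (2 * \<epsilon>) n k C} \<le> real n * fill_error \<epsilon> n" .
  qed
  also have "\<dots> = real (card ?I) * (real n * fill_error \<epsilon> n)" by simp
  also have "\<dots> \<le> real n * (real n * fill_error \<epsilon> n)"
    using card_mono[OF _ In] fill_error_nonneg[of \<epsilon> n] by (intro mult_right_mono) auto
  finally show ?thesis by (simp add: power2_eq_square mult.assoc)
qed

lemma fill_error_tendsto:
  assumes "\<epsilon> > 0"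
  shows "(\<lambda>n. (real n)\<^sup>2 * fill_error \<epsilon> n) \<longlonglongrightarrow> 0"
proof -
  define c where "c = \<epsilon> / 500"
  have c: "c > 0" using assms by (simp add: c_def)
  have "(\<lambda>n. (real n)\<^sup>2 * (1 / 2 ^ n)) \<longlonglongrightarrow> 0" by real_asymp
  moreover have "(\<lambda>n. (real n)\<^sup>2 * (real n * exp (2 / 5 - 7 / 100 * real n))) \<longlonglongrightarrow> 0"
    by real_asymp
  moreover have "(\<lambda>n. (real n)\<^sup>2 * exp (- (c * real n))) \<longlonglongrightarrow> 0"
    using c by real_asymp
  ultimately have "(\<lambda>n. (real n)\<^sup>2 * (1 / 2 ^ n) + (real n)\<^sup>2 * (real n * exp (2 / 5 - 7 / 100 * real n)) +
      (real n)\<^sup>2 * exp (- (c * real n))) \<longlonglongrightarrow> 0 + 0 + 0"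
    by (intro tendsto_add)
  then show ?thesis by (simp add: fill_error_def c_def distrib_left)
qed

theorem theorem3:
  fixes \<epsilon> :: real
  assumes "0 < \<epsilon>" and "\<epsilon> \<le> 1/100"
  shows "(\<lambda>n. measure_pmf.prob (dla_final n)
            {C. \<forall>k::nat. real k < \<epsilon>^3 * real n \<longrightarrow>
                 real (card {x \<in> C. card x = k}) \<ge> (1 - 2*\<epsilon>) * real (n choose k)})
         \<longlonglongrightarrow> 1"
proof -
  let ?G = "\<lambda>n. {C. \<forall>k::nat. real k < \<epsilon>^3 * real n \<longrightarrow>
                 real (card {x \<in> C. card x = k}) \<ge> (1 - 2*\<epsilon>) * real (n choose k)}"
  \<comment> \<open>This supplies the slack that turns \<open>k < \<epsilon> ^ 3 * n\<close> into
    \<open>k + 1 \<le> 2 * \<epsilon> ^ 3 * n\<close>, as the level induction requires.\<close>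
  have "eventually (\<lambda>n. 1 \<le> \<epsilon> ^ 3 * real n) sequentially"
    using assms(1) by real_asymp
  then have lower: "eventually (\<lambda>n. 1 - (real n)\<^sup>2 * fill_error \<epsilon> n \<le> measure_pmf.prob (dla_final n) (?G n)) sequentially"
    using eventually_ge_at_top[of 10000]
  proof eventually_elim
    case (elim n)
    have "{C. \<not> (\<forall>k::nat. real k < \<epsilon>^3 * real n \<longrightarrow>
       real (card {x \<in> C. card x = k}) \<ge> (1 - 2*\<epsilon>) * real (n choose k))} = space (dla_final n) - ?G n"
      by auto
    then have "measure_pmf.prob (dla_final n) (space (dla_final n) - ?G n) \<le> (real n)\<^sup>2 * fill_error \<epsilon> n"
      using prob_level_sparse_final_le[OF assms elim(2,1)] by (simp only:)
    moreover have "measure_pmf.prob (dla_final n) (space (dla_final n) - ?G n) =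
        1 - measure_pmf.prob (dla_final n) (?G n)"
      by (rule measure_pmf.prob_compl) simp
    ultimately show ?case by linarith
  qed
  have lim: "(\<lambda>n. 1 - (real n)\<^sup>2 * fill_error \<epsilon> n) \<longlonglongrightarrow> 1"
    using tendsto_diff[OF tendsto_const[of 1] fill_error_tendsto[OF assms(1)]] by simp
  show ?thesis by (rule tendsto_sandwich[OF lower _ lim tendsto_const]) simp
qed

end
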